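(* Let $G$ be an abelian Lie group isomorphic to $(\mathbb{R}^d,+)$ and let $(E_i,\pi_i,M_i,S_{ij},D_{ij})$, $i,j\in\{1,\dots,n\}$, be a hybrid principal $G$-bundle. Assume that each principal $G$-bundle $E_i\xrightarrow{\pi_i}M_i$ is equipped with a connection 1-form $\omega_i:TE_i\to T_eG$ and a local section $\sigma_i:U_i\to E_i$, $U_i\subset M_i$, inducing a local trivialization with coordinates $(m_i,g_i)$, in which $\omega_i=dg_i+A_i(m_i)\,dm_i$. Assume that $S_{ij}\cap U_i\neq\emptyset$ and that each form $A_i\,dm_i$ is exact on $M_i$, i.e. there is a function $F_i:M_i\to G$ with $A_i\,dm_i=dF_i$. Let $\gamma:[0,1]\to\bigcup_i U_i$ be a loop in the hybrid base space with $\gamma(0)=\gamma(1)=m_0$, let $t_1<\dots<t_N$ be its transition times, put $t_0=0$, $t_{N+1}=1$, and let $i(k)$ be the index of the component containing $\gamma$ between $t_k$ and $t_{k+1}$. Then the holonomy element $\Delta g$ of the hybrid bundle generated by $\gamma$ is $$\Delta g=\int_\gamma (A_1\,dm_1,\dots,A_n\,dm_n)=\sum_{k=0}^{N}\Big(F_{i(k)}\big(\gamma(t_{k+1})^-\big)-F_{i(k)}\big(\gamma(t_k)^+\big)\Big),$$ where $\gamma(t_k)^-$ and $\gamma(t_k)^+$ are the values of the loop before and after the transition at $t_k$, related by $\gamma(t_k)^+=\Delta_{i(k-1)i(k)}\big(\gamma(t_k)^-\big)$ for $1\le k\le N$, and $\gamma(t_0)^+=\gamma(t_{N+1})^-=m_0$.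 In particular, the holonomy depends only on the connections (from which the $F_i$ are obtained) and on what happens on the guards: $\Delta g=\Delta g\big(\omega_i,\gamma|_{\bigcup S_{ij}}\big)$.
   Context: A hybrid principal $G$-bundle consists of principal $G$-bundles $\pi_i:E_i\to M_i$ of smooth manifolds; guards $S_{ij}\subset M_i$, submanifolds of codimension 1; and resets $D_{ij}=(\Delta_{ij},\tilde\Delta_{ij})$ with $\Delta_{ij}:S_{ij}\to M_j$, $\tilde\Delta_{ij}:\pi_i^{-1}(S_{ij})\to\pi_j^{-1}(M_j)$ and $\pi_j\circ\tilde\Delta_{ij}=\Delta_{ij}\circ\pi_i$. A connection 1-form assigns to each tangent vector of the total space the infinitesimal generator (in the Lie algebra $T_eG$) of its vertical part; horizontal vectors are those in its kernel. A loop in the hybrid base space is a curve $\gamma:[0,1]\to\bigcup_i M_i$ with $\gamma(0)=\gamma(1)$ such that $\lim_{t\to t_0^+}\gamma(t)=\lim_{t\to t_0^-}\Delta_{ij}(\gamma(t))$ at every transition time, i.e. every $t_0$ with $\gamma(t_0)\in S_{ij}$ and $\gamma'$ not tangent to $S_{ij}$ at $t_0$. The hybrid lift of $\gamma$ through a point $e_0$ over $\gamma(0)$ is the curve $\tilde\gamma$ in $\bigcup_i E_i$ with $\tilde\gamma(0)=e_0$ which on each interval between consecutive transition times $t_k,t_{k+1}$ is the horizontal lift of $\gamma$ in $E_{i(k)}\to M_{i(k)}$, starting after the transition at $t_k$ from the image under $\tilde\Delta_{i(k-1)i(k)}$ of the value of $\tilde\gamma$ just before the transition. The holonomy element generated by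 $\gamma$ is the element of $G$ that takes $\tilde\gamma(0)$ to $\tilde\gamma(1)$ under the $G$-action. The integral of a tuple of 1-forms over a hybrid curve is the sum over the intervals $[t_k,t_{k+1}]$ of the integral of the form belonging to the component $i(k)$.
   Formalization: The printed sign is wrong: with ω_i = dg_i + A_i dm_i the holonomy is Δg = −∫_γ(A_1dm_1,…), which is what is proved. Also assumed: the lifted resets preserve the group coordinate g_i over the trivialized sets, since otherwise a reset shifting g would change the holonomy. *)

theory Defs
  imports "HOL-Analysis.Analysis" "HOL-Algebra.Group"
begin

section \<open>Smooth functions on subsets of Euclidean spaces\<close>

primrec Ck_on :: "nat \<Rightarrow> 'a::real_normed_vector set \<Rightarrow> ('a \<Rightarrow> 'b::real_normed_vector) \<Rightarrow> bool" where
  "Ck_on 0 N f = continuous_on N f"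
| "Ck_on (Suc k) N f =
     ((\<forall>x\<in>N. f differentiable at x) \<and> (\<forall>v. Ck_on k N (\<lambda>x. frechet_derivative f (at x) v)))"

text \<open>On an arbitrary set, smooth means locally extendable to a \<open>C\<^sup>\<infinity>\<close> function on an open set. This is
  needed because charts take values in a linear subspace (see below).\<close>

definition smooth_on :: "'a::real_normed_vector set \<Rightarrow> ('a \<Rightarrow> 'b::real_normed_vector) \<Rightarrow> bool" where
  "smooth_on S f \<longleftrightarrow>
     (\<forall>x\<in>S. \<exists>N g. open N \<and> x \<in> N \<and> (\<forall>k. Ck_on k N g) \<and> (\<forall>y\<in>N \<inter> S. g y = f y))"

section \<open>Smooth manifolds\<close>

text \<open>Charts take values in a linear subspace \<open>model_space\<close> of a Euclidean space, so that manifolds of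
  different dimensions \<open>dim (model_space M)\<close> can share one type. An atlas element is a pair of a
  domain and a coordinate map.\<close>

record ('a, 'v) manifold =
  man_top :: "'a topology"
  model_space :: "'v set"
  atlas :: "('a set \<times> ('a \<Rightarrow> 'v)) set"

abbreviation points :: "('a, 'v) manifold \<Rightarrow> 'a set" where
  "points M \<equiv> topspace (man_top M)"

definition topological_chart :: "('a, 'v::euclidean_space) manifold \<Rightarrow> 'a set \<Rightarrow> ('a \<Rightarrow> 'v) \<Rightarrow> bool" where
  "topological_chart M D \<phi> \<longleftrightarrow>
     openin (man_top M) D \<and> openin (top_of_set (model_space M)) (\<phi> ` D) \<and>
     homeomorphic_map (subtopology (man_top M) D) (top_of_set (\<phi> ` D)) \<phi>"

definition smooth_transition :: "'a set \<Rightarrow> ('a \<Rightarrow> 'v::euclidean_space) \<Rightarrow> 'a set \<Rightarrow> ('a \<Rightarrow> 'v) \<Rightarrow> bool" where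
  "smooth_transition D \<phi> D' \<phi>' \<longleftrightarrow> smooth_on (\<phi> ` (D \<inter> D')) (\<lambda>x. \<phi>' (inv_into D \<phi> x))"

definition smooth_manifold :: "('a, 'v::euclidean_space) manifold \<Rightarrow> bool" where
  "smooth_manifold M \<longleftrightarrow>
     Hausdorff_space (man_top M) \<and> second_countable (man_top M) \<and> subspace (model_space M) \<and>
     (\<forall>(D, \<phi>)\<in>atlas M. topological_chart M D \<phi>) \<and>
     (\<Union>(D, \<phi>)\<in>atlas M. D) = points M \<and>
     (\<forall>(D, \<phi>)\<in>atlas M. \<forall>(D', \<phi>')\<in>atlas M. smooth_transition D \<phi> D' \<phi>')"

definition smooth_chart :: "('a, 'v::euclidean_space) manifold \<Rightarrow> 'a set \<Rightarrow> ('a \<Rightarrow> 'v) \<Rightarrow> bool" where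
  "smooth_chart M D \<phi> \<longleftrightarrow>
     topological_chart M D \<phi> \<and>
     (\<forall>(D', \<phi>')\<in>atlas M. smooth_transition D \<phi> D' \<phi>' \<and> smooth_transition D' \<phi>' D \<phi>)"

definition smooth_near :: "('a, 'v::euclidean_space) manifold \<Rightarrow> 'a \<Rightarrow> ('a \<Rightarrow> real) \<Rightarrow> bool" where
  "smooth_near M p f \<longleftrightarrow>
     (\<exists>W. openin (man_top M) W \<and> p \<in> W \<and>
        (\<forall>(D, \<phi>)\<in>atlas M. smooth_on (\<phi> ` (D \<inter> W)) (\<lambda>x. f (inv_into D \<phi> x))))"

text \<open>A map on an open set is smooth if it is continuous and pulls locally smooth functions back to
  locally smooth functions.\<close>

definition smooth_map ::
  "('a, 'v::euclidean_space) manifold \<Rightarrow> ('b, 'w::euclidean_space) manifold \<Rightarrow> 'a set \<Rightarrow> ('a \<Rightarrow> 'b) \<Rightarrow> bool"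
where
  "smooth_map M N W F \<longleftrightarrow>
     openin (man_top M) W \<and> continuous_map (subtopology (man_top M) W) (man_top N) F \<and>
     (\<forall>p\<in>W. \<forall>f. smooth_near N (F p) f \<longrightarrow> smooth_near M p (\<lambda>q. f (F q)))"

definition product_manifold ::
  "('a, 'v::euclidean_space) manifold \<Rightarrow> ('b, 'w::euclidean_space) manifold \<Rightarrow> ('a \<times> 'b, 'v \<times> 'w) manifold"
where
  "product_manifold M N =
     \<lparr>man_top = prod_topology (man_top M) (man_top N),
      model_space = model_space M \<times> model_space N,
      atlas = {(D \<times> D', map_prod \<phi> \<psi>) |D \<phi> D' \<psi>. (D, \<phi>) \<in> atlas M \<and> (D', \<psi>) \<in> atlas N}\<rparr>"

definition euclidean_manifold :: "('a::euclidean_space, 'a) manifold" where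
  "euclidean_manifold = \<lparr>man_top = euclidean, model_space = UNIV, atlas = {(UNIV, id)}\<rparr>"

text \<open>Embedded submanifolds of codimension 1, by slice charts.\<close>

definition codim1_submanifold :: "('a, 'v::euclidean_space) manifold \<Rightarrow> 'a set \<Rightarrow> bool" where
  "codim1_submanifold M S \<longleftrightarrow>
     S \<subseteq> points M \<and>
     (\<forall>p\<in>S. \<exists>D \<phi> V. smooth_chart M D \<phi> \<and> p \<in> D \<and> subspace V \<and> V \<subseteq> model_space M \<and>
        dim (model_space M) = dim V + 1 \<and> \<phi> ` (D \<inter> S) = \<phi> ` D \<inter> V)"

section \<open>Tangent vectors and curves\<close>

text \<open>Tangent vectors at \<open>p\<close> are derivations of the germs at \<open>p\<close> of smooth functions. To make them
  unique as HOL functions they are set to 0 on functions that are not smooth near \<open>p\<close>.\<close>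

type_synonym 'a tangent = "('a \<Rightarrow> real) \<Rightarrow> real"

definition tangent_space :: "('a, 'v::euclidean_space) manifold \<Rightarrow> 'a \<Rightarrow> 'a tangent set" where
  "tangent_space M p =
     {X. (\<forall>f. \<not> smooth_near M p f \<longrightarrow> X f = 0) \<and>
         (\<forall>f g a b. smooth_near M p f \<and> smooth_near M p g \<longrightarrow>
            X (\<lambda>q. a * f q + b * g q) = a * X f + b * X g \<and>
            X (\<lambda>q. f q * g q) = f p * X g + g p * X f) \<and>
         (\<forall>f g W. smooth_near M p f \<and> smooth_near M p g \<and> openin (man_top M) W \<and> p \<in> W \<and>
            (\<forall>q\<in>W. f q = g q) \<longrightarrow> X f = X g)}"

text \<open>The image of a tangent vector under the differential of \<open>F\<close> at a point mapped to \<open>q\<close>.\<close>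

definition pushforward ::
  "('b, 'w::euclidean_space) manifold \<Rightarrow> 'b \<Rightarrow> ('a \<Rightarrow> 'b) \<Rightarrow> 'a tangent \<Rightarrow> 'b tangent"
where
  "pushforward N q F X = (\<lambda>f. if smooth_near N q f then X (\<lambda>p. f (F p)) else 0)"

definition differentiable_curve :: "('a, 'v::euclidean_space) manifold \<Rightarrow> real set \<Rightarrow> (real \<Rightarrow> 'a) \<Rightarrow> bool" where
  "differentiable_curve M I c \<longleftrightarrow>
     continuous_map (top_of_set I) (man_top M) c \<and>
     (\<forall>s\<in>I. \<forall>f. smooth_near M (c s) f \<longrightarrow> (\<lambda>r. f (c r)) differentiable (at s within I))"

text \<open>The parameter set \<open>I\<close> gives access to one-sided velocities.\<close>

definition velocity :: "('a, 'v::euclidean_space) manifold \<Rightarrow> real set \<Rightarrow> (real \<Rightarrow> 'a) \<Rightarrow> real \<Rightarrow> 'a tangent" where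
  "velocity M I c s =
     (\<lambda>f. if smooth_near M (c s) f then vector_derivative (\<lambda>r. f (c r)) (at s within I) else 0)"

definition tangent_to :: "('a, 'v::euclidean_space) manifold \<Rightarrow> 'a set \<Rightarrow> 'a \<Rightarrow> 'a tangent \<Rightarrow> bool" where
  "tangent_to M S p X \<longleftrightarrow>
     (\<exists>c \<epsilon>. \<epsilon> > 0 \<and> differentiable_curve M {-\<epsilon>..\<epsilon>} c \<and> c ` {-\<epsilon>..\<epsilon>} \<subseteq> S \<and> c 0 = p \<and>
        X = velocity M {-\<epsilon>..\<epsilon>} c 0)"

definition coord_vector :: "('a, 'v::euclidean_space) manifold \<Rightarrow> 'a set \<Rightarrow> ('a \<Rightarrow> 'v) \<Rightarrow> 'v \<Rightarrow> 'a \<Rightarrow> 'a tangent" where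
  "coord_vector M D \<phi> v p =
     (\<lambda>f. if smooth_near M p f
          then vector_derivative (\<lambda>s. f (inv_into D \<phi> (\<phi> p + s *\<^sub>R v))) (at 0) else 0)"

section \<open>Lie groups and Lie-algebra-valued 1-forms\<close>

record ('h, 'w) lie_grp = "'h monoid" +
  grp_man :: "('h, 'w) manifold"

definition lie_group :: "('h, 'w::euclidean_space) lie_grp \<Rightarrow> bool" where
  "lie_group G \<longleftrightarrow>
     group G \<and> smooth_manifold (grp_man G) \<and> points (grp_man G) = carrier G \<and>
     smooth_map (product_manifold (grp_man G) (grp_man G)) (grp_man G) (carrier G \<times> carrier G)
       (\<lambda>(x, y). x \<otimes>\<^bsub>G\<^esub> y) \<and>
     smooth_map (grp_man G) (grp_man G) (carrier G) (\<lambda>x. inv\<^bsub>G\<^esub> x)"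

abbreviation lie_algebra :: "('h, 'w::euclidean_space) lie_grp \<Rightarrow> 'h tangent set" where
  "lie_algebra G \<equiv> tangent_space (grp_man G) \<one>\<^bsub>G\<^esub>"

definition lie_group_iso_Rn :: "('h, 'w::euclidean_space) lie_grp \<Rightarrow> ('h \<Rightarrow> real ^ 'd) \<Rightarrow> bool" where
  "lie_group_iso_Rn G \<Phi> \<longleftrightarrow>
     bij_betw \<Phi> (carrier G) UNIV \<and>
     (\<forall>x\<in>carrier G. \<forall>y\<in>carrier G. \<Phi> (x \<otimes>\<^bsub>G\<^esub> y) = \<Phi> x + \<Phi> y) \<and>
     smooth_map (grp_man G) euclidean_manifold (carrier G) \<Phi> \<and>
     smooth_map euclidean_manifold (grp_man G) UNIV (inv_into (carrier G) \<Phi>)"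

text \<open>The differential of \<open>\<Phi>\<close> at the identity, an identification of the Lie algebra with \<open>\<real>\<^sup>d\<close>.\<close>

definition lie_algebra_coords :: "('h \<Rightarrow> real ^ 'd) \<Rightarrow> 'h tangent \<Rightarrow> real ^ 'd" where
  "lie_algebra_coords \<Phi> \<xi> = (\<chi> b. \<xi> (\<lambda>h. \<Phi> h $ b))"

text \<open>The differential \<open>dF\<close> of a \<open>G\<close>-valued map, with values in the Lie algebra: the derivative of
  \<open>F\<close> at \<open>p\<close> translated from \<open>F p\<close> to the identity.\<close>

definition grp_differential ::
  "('h, 'w::euclidean_space) lie_grp \<Rightarrow> ('a \<Rightarrow> 'h) \<Rightarrow> 'a \<Rightarrow> 'a tangent \<Rightarrow> 'h tangent"
where
  "grp_differential G F p X =
     pushforward (grp_man G) \<one>\<^bsub>G\<^esub> (\<lambda>q. inv\<^bsub>G\<^esub> (F p) \<otimes>\<^bsub>G\<^esub> F q) X"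

type_synonym ('a, 'h) lie_valued_form = "'a \<Rightarrow> 'a tangent \<Rightarrow> 'h tangent"

definition smooth_form_on ::
  "('a, 'v::euclidean_space) manifold \<Rightarrow> ('h, 'w::euclidean_space) lie_grp \<Rightarrow> 'a set
     \<Rightarrow> ('a, 'h) lie_valued_form \<Rightarrow> bool"
where
  "smooth_form_on M G W \<alpha> \<longleftrightarrow>
     openin (man_top M) W \<and>
     (\<forall>p\<in>W. \<forall>X\<in>tangent_space M p. \<alpha> p X \<in> lie_algebra G) \<and>
     (\<forall>p\<in>W. \<forall>X\<in>tangent_space M p. \<forall>Y\<in>tangent_space M p. \<forall>a b.
        \<alpha> p (\<lambda>f. a * X f + b * Y f) = (\<lambda>f. a * \<alpha> p X f + b * \<alpha> p Y f)) \<and>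
     (\<forall>(D, \<phi>)\<in>atlas M. \<forall>v\<in>model_space M. \<forall>p\<in>D \<inter> W. \<forall>f. smooth_near (grp_man G) \<one>\<^bsub>G\<^esub> f \<longrightarrow>
        smooth_near M p (\<lambda>q. \<alpha> q (coord_vector M D \<phi> v q) f))"

section \<open>Principal bundles and connections\<close>

record ('e, 'u, 'm, 'v, 'h) g_bundle =
  total_space :: "('e, 'u) manifold"
  base_space :: "('m, 'v) manifold"
  bundle_proj :: "'e \<Rightarrow> 'm"
  action :: "'e \<Rightarrow> 'h \<Rightarrow> 'e"

definition part_over :: "('e, 'u, 'm, 'v, 'h) g_bundle \<Rightarrow> 'm set \<Rightarrow> 'e set" where
  "part_over P U = {e \<in> points (total_space P). bundle_proj P e \<in> U}"

definition local_trivialization ::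
  "('h, 'w::euclidean_space) lie_grp \<Rightarrow> ('e, 'u::euclidean_space, 'm, 'v::euclidean_space, 'h) g_bundle
     \<Rightarrow> 'm set \<Rightarrow> ('e \<Rightarrow> 'm \<times> 'h) \<Rightarrow> bool"
where
  "local_trivialization G P U \<psi> \<longleftrightarrow>
     openin (man_top (base_space P)) U \<and>
     bij_betw \<psi> (part_over P U) (U \<times> carrier G) \<and>
     smooth_map (total_space P) (product_manifold (base_space P) (grp_man G)) (part_over P U) \<psi> \<and>
     smooth_map (product_manifold (base_space P) (grp_man G)) (total_space P) (U \<times> carrier G)
       (inv_into (part_over P U) \<psi>) \<and>
     (\<forall>e\<in>part_over P U. fst (\<psi> e) = bundle_proj P e \<and>
        (\<forall>h\<in>carrier G. \<psi> (action P e h) = (bundle_proj P e, snd (\<psi> e) \<otimes>\<^bsub>G\<^esub> h)))"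

definition principal_bundle ::
  "('h, 'w::euclidean_space) lie_grp \<Rightarrow> ('e, 'u::euclidean_space, 'm, 'v::euclidean_space, 'h) g_bundle \<Rightarrow> bool"
where
  "principal_bundle G P \<longleftrightarrow>
     lie_group G \<and> smooth_manifold (total_space P) \<and> smooth_manifold (base_space P) \<and>
     smooth_map (total_space P) (base_space P) (points (total_space P)) (bundle_proj P) \<and>
     bundle_proj P ` points (total_space P) = points (base_space P) \<and>
     smooth_map (product_manifold (total_space P) (grp_man G)) (total_space P)
       (points (total_space P) \<times> carrier G) (\<lambda>(e, h). action P e h) \<and>
     (\<forall>e\<in>points (total_space P). action P e \<one>\<^bsub>G\<^esub> = e \<and>
        (\<forall>h\<in>carrier G. bundle_proj P (action P e h) = bundle_proj P e \<and>
           (\<forall>h'\<in>carrier G. action P (action P e h) h' = action P e (h \<otimes>\<^bsub>G\<^esub> h')))) \<and>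
     (\<forall>m\<in>points (base_space P). \<exists>U \<psi>. m \<in> U \<and> local_trivialization G P U \<psi>)"

text \<open>\<open>pushforward \<dots> (action P e) \<xi>\<close> is the vertical vector at \<open>e\<close> whose infinitesimal generator is \<open>\<xi>\<close>.
  The last clause is \<open>Ad\<close>-equivariance.\<close>

definition connection_form ::
  "('h, 'w::euclidean_space) lie_grp \<Rightarrow> ('e, 'u::euclidean_space, 'm, 'v::euclidean_space, 'h) g_bundle
     \<Rightarrow> ('e, 'h) lie_valued_form \<Rightarrow> bool"
where
  "connection_form G P \<omega> \<longleftrightarrow>
     smooth_form_on (total_space P) G (points (total_space P)) \<omega> \<and>
     (\<forall>e\<in>points (total_space P). \<forall>\<xi>\<in>lie_algebra G.
        \<omega> e (pushforward (total_space P) e (action P e) \<xi>) = \<xi>) \<and>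
     (\<forall>e\<in>points (total_space P). \<forall>X\<in>tangent_space (total_space P) e. \<forall>h\<in>carrier G.
        \<omega> (action P e h) (pushforward (total_space P) (action P e h) (\<lambda>e'. action P e' h) X) =
        pushforward (grp_man G) \<one>\<^bsub>G\<^esub> (\<lambda>x. inv\<^bsub>G\<^esub> h \<otimes>\<^bsub>G\<^esub> x \<otimes>\<^bsub>G\<^esub> h) (\<omega> e X))"

definition local_section ::
  "('e, 'u::euclidean_space, 'm, 'v::euclidean_space, 'h) g_bundle \<Rightarrow> 'm set \<Rightarrow> ('m \<Rightarrow> 'e) \<Rightarrow> bool"
where
  "local_section P U \<sigma> \<longleftrightarrow>
     smooth_map (base_space P) (total_space P) U \<sigma> \<and> (\<forall>m\<in>U. bundle_proj P (\<sigma> m) = m)"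

text \<open>The group coordinate \<open>g\<close> of the trivialization \<open>(m, g) \<mapsto> \<sigma> m \<cdot> g\<close> induced by a section.\<close>

definition grp_coord ::
  "('h, 'w::euclidean_space) lie_grp \<Rightarrow> ('e, 'u::euclidean_space, 'm, 'v::euclidean_space, 'h) g_bundle
     \<Rightarrow> ('m \<Rightarrow> 'e) \<Rightarrow> 'e \<Rightarrow> 'h"
where
  "grp_coord G P \<sigma> e = (THE g. g \<in> carrier G \<and> e = action P (\<sigma> (bundle_proj P e)) g)"

definition section_trivialization ::
  "('h, 'w::euclidean_space) lie_grp \<Rightarrow> ('e, 'u::euclidean_space, 'm, 'v::euclidean_space, 'h) g_bundle
     \<Rightarrow> ('m \<Rightarrow> 'e) \<Rightarrow> 'e \<Rightarrow> 'm \<times> 'h"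
where
  "section_trivialization G P \<sigma> e = (bundle_proj P e, grp_coord G P \<sigma> e)"

section \<open>Hybrid principal bundles\<close>

record ('e, 'u, 'm, 'v, 'h) hybrid_bundle =
  num :: nat
  comp_bundle :: "nat \<Rightarrow> ('e, 'u, 'm, 'v, 'h) g_bundle"
  guard :: "nat \<Rightarrow> nat \<Rightarrow> 'm set"
  reset :: "nat \<Rightarrow> nat \<Rightarrow> 'm \<Rightarrow> 'm"
  lifted_reset :: "nat \<Rightarrow> nat \<Rightarrow> 'e \<Rightarrow> 'e"

abbreviation base :: "('e, 'u, 'm, 'v, 'h) hybrid_bundle \<Rightarrow> nat \<Rightarrow> ('m, 'v) manifold" where
  "base H i \<equiv> base_space (comp_bundle H i)"

abbreviation tot :: "('e, 'u, 'm, 'v, 'h) hybrid_bundle \<Rightarrow> nat \<Rightarrow> ('e, 'u) manifold" where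
  "tot H i \<equiv> total_space (comp_bundle H i)"

text \<open>An empty guard \<open>guard H i j\<close> means that there are no transitions from \<open>i\<close> to \<open>j\<close>.\<close>

definition hybrid_principal_bundle ::
  "('h, 'w::euclidean_space) lie_grp
     \<Rightarrow> ('e, 'u::euclidean_space, 'm, 'v::euclidean_space, 'h) hybrid_bundle \<Rightarrow> bool"
where
  "hybrid_principal_bundle G H \<longleftrightarrow>
     (\<forall>i\<in>{1..num H}. principal_bundle G (comp_bundle H i)) \<and>
     (\<forall>i\<in>{1..num H}. \<forall>j\<in>{1..num H}.
        codim1_submanifold (base H i) (guard H i j) \<and>
        reset H i j ` guard H i j \<subseteq> points (base H j) \<and>
        lifted_reset H i j ` part_over (comp_bundle H i) (guard H i j) \<subseteq> points (tot H j) \<and>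
        (\<forall>e\<in>part_over (comp_bundle H i) (guard H i j).
           bundle_proj (comp_bundle H j) (lifted_reset H i j e) =
           reset H i j (bundle_proj (comp_bundle H i) e)))"

section \<open>Hybrid curves\<close>

text \<open>The union of the components is a disjoint union, whose points are pairs of an index and a
  point of the component with that index.\<close>

definition disjoint_union :: "nat \<Rightarrow> (nat \<Rightarrow> ('a, 'v) manifold) \<Rightarrow> (nat \<times> 'a) topology" where
  "disjoint_union n X = sum_topology (\<lambda>i. man_top (X i)) {1..n}"

abbreviation base_union :: "('e, 'u, 'm, 'v, 'h) hybrid_bundle \<Rightarrow> (nat \<times> 'm) topology" where
  "base_union H \<equiv> disjoint_union (num H) (base H)"

abbreviation tot_union :: "('e, 'u, 'm, 'v, 'h) hybrid_bundle \<Rightarrow> (nat \<times> 'e) topology" where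
  "tot_union H \<equiv> disjoint_union (num H) (tot H)"

definition value_before :: "'a topology \<Rightarrow> (real \<Rightarrow> 'a) \<Rightarrow> real \<Rightarrow> 'a" where
  "value_before T \<gamma> s = (THE p. limitin T \<gamma> p (at_left s))"

definition value_after :: "'a topology \<Rightarrow> (real \<Rightarrow> 'a) \<Rightarrow> real \<Rightarrow> 'a" where
  "value_after T \<gamma> s = (THE p. limitin T \<gamma> p (at_right s))"

text \<open>Hybrid curves are left-continuous: at a transition time the value is the point on the guard.
  The piece of a curve that starts at time \<open>a\<close> starts at the value after the transition.\<close>

definition piece :: "(nat \<times> 'a) topology \<Rightarrow> (real \<Rightarrow> nat \<times> 'a) \<Rightarrow> real \<Rightarrow> real \<Rightarrow> 'a" where
  "piece T \<gamma> a s = snd (if s = a then value_after T \<gamma> a else \<gamma> s)"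

definition comp_index :: "(real \<Rightarrow> nat \<times> 'a) \<Rightarrow> (nat \<Rightarrow> real) \<Rightarrow> nat \<Rightarrow> nat" where
  "comp_index \<gamma> t k = fst (\<gamma> (t (Suc k)))"

definition hybrid_curve ::
  "nat \<Rightarrow> (nat \<Rightarrow> ('a, 'v::euclidean_space) manifold) \<Rightarrow> nat \<Rightarrow> (nat \<Rightarrow> real)
     \<Rightarrow> (real \<Rightarrow> nat \<times> 'a) \<Rightarrow> bool"
where
  "hybrid_curve n X N t \<gamma> \<longleftrightarrow>
     t 0 = 0 \<and> t (Suc N) = 1 \<and> (\<forall>k\<le>N. t k < t (Suc k)) \<and>
     limitin (disjoint_union n X) \<gamma> (\<gamma> 0) (at_right 0) \<and>
     (\<forall>k\<le>N. comp_index \<gamma> t k \<in> {1..n} \<and>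
        (\<forall>s\<in>{t k<..t (Suc k)}. fst (\<gamma> s) = comp_index \<gamma> t k) \<and>
        (\<exists>p. limitin (disjoint_union n X) \<gamma> p (at_right (t k))) \<and>
        differentiable_curve (X (comp_index \<gamma> t k)) {t k..t (Suc k)}
          (piece (disjoint_union n X) \<gamma> (t k)))"

definition transition ::
  "('e, 'u::euclidean_space, 'm, 'v::euclidean_space, 'h) hybrid_bundle
     \<Rightarrow> (real \<Rightarrow> nat \<times> 'm) \<Rightarrow> real \<Rightarrow> nat \<Rightarrow> bool"
where
  "transition H \<gamma> s j \<longleftrightarrow>
     0 < s \<and> s < 1 \<and> j \<in> {1..num H} \<and> snd (\<gamma> s) \<in> guard H (fst (\<gamma> s)) j \<and>
     \<not> tangent_to (base H (fst (\<gamma> s))) (guard H (fst (\<gamma> s)) j) (snd (\<gamma> s))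
         (velocity (base H (fst (\<gamma> s))) {..s} (\<lambda>r. snd (\<gamma> r)) s)"

text \<open>A loop in the hybrid base space with transition times \<open>t 1 < \<dots> < t N\<close>.\<close>

definition hybrid_loop ::
  "('e, 'u::euclidean_space, 'm, 'v::euclidean_space, 'h) hybrid_bundle \<Rightarrow> nat \<Rightarrow> (nat \<Rightarrow> real)
     \<Rightarrow> (real \<Rightarrow> nat \<times> 'm) \<Rightarrow> bool"
where
  "hybrid_loop H N t \<gamma> \<longleftrightarrow>
     hybrid_curve (num H) (base H) N t \<gamma> \<and> \<gamma> 0 = \<gamma> 1 \<and>
     {s. \<exists>j. transition H \<gamma> s j} = t ` {1..N} \<and>
     (\<forall>s j. transition H \<gamma> s j \<longrightarrow>
        limitin (base_union H) \<gamma> (j, reset H (fst (\<gamma> s)) j (snd (\<gamma> s))) (at_right s))"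

text \<open>Since values at transition times are values before the transition, the values after it have
  to be mentioned separately.\<close>

definition hybrid_curve_in ::
  "('e, 'u::euclidean_space, 'm, 'v::euclidean_space, 'h) hybrid_bundle \<Rightarrow> (nat \<Rightarrow> 'm set)
     \<Rightarrow> nat \<Rightarrow> (nat \<Rightarrow> real) \<Rightarrow> (real \<Rightarrow> nat \<times> 'm) \<Rightarrow> bool"
where
  "hybrid_curve_in H U N t \<gamma> \<longleftrightarrow>
     (\<forall>s\<in>{0..1}. \<gamma> s \<in> Sigma {1..num H} U) \<and>
     (\<forall>k\<le>N. value_after (base_union H) \<gamma> (t k) \<in> Sigma {1..num H} U)"

definition hybrid_lift ::
  "('e, 'u::euclidean_space, 'm, 'v::euclidean_space, 'h) hybrid_bundle
     \<Rightarrow> (nat \<Rightarrow> ('e, 'h) lie_valued_form) \<Rightarrow> nat \<Rightarrow> (nat \<Rightarrow> real) \<Rightarrow> (real \<Rightarrow> nat \<times> 'm)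
     \<Rightarrow> 'e \<Rightarrow> (real \<Rightarrow> nat \<times> 'e) \<Rightarrow> bool"
where
  "hybrid_lift H \<omega> N t \<gamma> e\<^sub>0 \<gamma>' \<longleftrightarrow>
     hybrid_curve (num H) (tot H) N t \<gamma>' \<and> \<gamma>' 0 = (fst (\<gamma> 0), e\<^sub>0) \<and>
     (\<forall>s\<in>{0..1}. fst (\<gamma>' s) = fst (\<gamma> s) \<and>
        bundle_proj (comp_bundle H (fst (\<gamma> s))) (snd (\<gamma>' s)) = snd (\<gamma> s)) \<and>
     (\<forall>k\<le>N. \<forall>s\<in>{t k..t (Suc k)}.
        \<omega> (comp_index \<gamma> t k) (piece (tot_union H) \<gamma>' (t k) s)
          (velocity (tot H (comp_index \<gamma> t k)) {t k..t (Suc k)} (piece (tot_union H) \<gamma>' (t k)) s) = (\<lambda>_. 0)) \<and>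
     (\<forall>k\<in>{1..N}. value_after (tot_union H) \<gamma>' (t k) =
        (comp_index \<gamma> t k,
         lifted_reset H (comp_index \<gamma> t (k - 1)) (comp_index \<gamma> t k)
           (snd (value_before (tot_union H) \<gamma>' (t k)))))"

definition generates_holonomy ::
  "('h, 'w::euclidean_space) lie_grp
     \<Rightarrow> ('e, 'u::euclidean_space, 'm, 'v::euclidean_space, 'h) hybrid_bundle
     \<Rightarrow> (nat \<Rightarrow> ('e, 'h) lie_valued_form) \<Rightarrow> nat \<Rightarrow> (nat \<Rightarrow> real) \<Rightarrow> (real \<Rightarrow> nat \<times> 'm)
     \<Rightarrow> 'e \<Rightarrow> 'h \<Rightarrow> bool"
where
  "generates_holonomy G H \<omega> N t \<gamma> e\<^sub>0 h \<longleftrightarrow>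
     h \<in> carrier G \<and>
     (\<exists>\<gamma>'. hybrid_lift H \<omega> N t \<gamma> e\<^sub>0 \<gamma>' \<and>
        snd (\<gamma>' 1) = action (comp_bundle H (fst (\<gamma> 0))) (snd (\<gamma>' 0)) h)"

definition holonomy_element ::
  "('h, 'w::euclidean_space) lie_grp
     \<Rightarrow> ('e, 'u::euclidean_space, 'm, 'v::euclidean_space, 'h) hybrid_bundle
     \<Rightarrow> (nat \<Rightarrow> ('e, 'h) lie_valued_form) \<Rightarrow> nat \<Rightarrow> (nat \<Rightarrow> real) \<Rightarrow> (real \<Rightarrow> nat \<times> 'm)
     \<Rightarrow> 'e \<Rightarrow> 'h"
where
  "holonomy_element G H \<omega> N t \<gamma> e\<^sub>0 = (THE h. generates_holonomy G H \<omega> N t \<gamma> e\<^sub>0 h)"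

text \<open>The integral over a hybrid curve of a tuple of Lie-algebra-valued forms, as an element of
  \<open>\<real>\<^sup>d\<close> by means of \<open>\<Phi>\<close>.\<close>

definition hybrid_integral ::
  "('h \<Rightarrow> real ^ 'd) \<Rightarrow> ('e, 'u::euclidean_space, 'm, 'v::euclidean_space, 'h) hybrid_bundle
     \<Rightarrow> (nat \<Rightarrow> ('m, 'h) lie_valued_form) \<Rightarrow> nat \<Rightarrow> (nat \<Rightarrow> real) \<Rightarrow> (real \<Rightarrow> nat \<times> 'm)
     \<Rightarrow> real ^ 'd"
where
  "hybrid_integral \<Phi> H A N t \<gamma> =
     (\<Sum>k=0..N. integral {t k..t (Suc k)} (\<lambda>s. lie_algebra_coords \<Phi>
        (A (comp_index \<gamma> t k) (piece (base_union H) \<gamma> (t k) s)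
          (velocity (base H (comp_index \<gamma> t k)) {t k..t (Suc k)} (piece (base_union H) \<gamma> (t k)) s))))"

end

theory Submission
  imports Defs
begin

text \<open>
  In the trivialization, the velocity of a curve with coordinates \<open>(m, g)\<close> is horizontal iff the derivative of
  \<open>\<Phi> g + \<Phi> (F m)\<close> vanishes, because \<open>A = dF\<close> and \<open>\<Phi>\<close> turns translations of the group into translations of
  \<open>\<real>\<^sup>d\<close>. So on each piece of a lift \<open>\<Phi> g\<close> decreases by exactly the increase of \<open>\<Phi> (F m)\<close>, which is the
  integral of \<open>A\<close>, and the resets do not change \<open>g\<close>. Conversely, solving \<open>\<Phi> g + \<Phi> (F m) = c\<close> for \<open>g\<close>
  on every piece gives a lift. The contributions of the pieces telescope around the loop to a sum over
  the guards.
\<close>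

section \<open>Closure properties of smooth functions\<close>

text \<open>A differentiable curve is known only through its compositions with locally smooth
  functions, and a velocity is a derivation. This is harmless under smooth maps, which pull such
  functions back, but it is the obstacle to building a lift: the curve \<open>(m, g)\<close> must be
  tested against functions on the product, which do not split into functions of \<open>m\<close> and
  of \<open>g\<close>. Charts, and with them the calculus of locally extendable functions, enter
  mainly there. No uniqueness theorem for horizontal lifts is used. Once horizontality is a zero
  derivative of a curve in \<real>^d, the endpoint of every lift can be computed, and that already
  makes the holonomy element unique. The sign comes from \<omega> = dg + A dm: along a horizontal
  curve dg = - A dm, so the element taking the start of the lift to its end is minus the integral.
  At a transition time a hybrid curve has two values. Only the one before is a value of the
  function; the one after is a right-hand limit, so facts about it come from continuity and the
  Hausdorff property of the components.\<close>

lemma Ck_on_subset: "Ck_on k N f \<Longrightarrow> N' \<subseteq> N \<Longrightarrow> Ck_on k N' f"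
  by (induction k arbitrary: f) (auto intro: continuous_on_subset)

lemma Ck_on_Suc_imp: "Ck_on (Suc k) N f \<Longrightarrow> Ck_on k N f"
proof (induction k arbitrary: f)
  case 0
  then show ?case
    by (auto intro!: continuous_at_imp_continuous_on differentiable_imp_continuous_within)
next
  case (Suc k)
  then show ?case by (metis Ck_on.simps(2))
qed

lemma Ck_on_cong:
  assumes "open N" and "Ck_on k N f" and "\<And>x. x \<in> N \<Longrightarrow> f x = g x"
  shows "Ck_on k N g"
  using assms(2,3)
proof (induction k arbitrary: f g)
  case 0
  then show ?case using continuous_on_cong[of N N f g] by simp
next
  case (Suc k)
  have d: "g differentiable at x" if "x \<in> N" for x
    using Suc.prems assms(1) that unfolding differentiable_def
    by (metis Ck_on.simps(2) has_derivative_transform_within_open differentiable_def)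
  have "Ck_on k N (\<lambda>x. frechet_derivative g (at x) v)" for v
  proof (rule Suc.IH[of "\<lambda>x. frechet_derivative f (at x) v"])
    show "Ck_on k N (\<lambda>x. frechet_derivative f (at x) v)" using Suc.prems by simp
    show "frechet_derivative f (at x) v = frechet_derivative g (at x) v" if "x \<in> N" for x
      using frechet_derivative_transform_within_open[of f x N g] Suc.prems assms(1) that by simp
  qed
  with d show ?case by simp
qed

text \<open>Calculus rules supply some derivative \<open>f'\<close>, whereas \<open>Ck_on\<close>
  speaks of the chosen \<open>frechet_derivative\<close>; uniqueness of derivatives at a point
  identifies the two. The inductive steps for the closure properties below all pass through this
  rule.\<close>

lemma Ck_on_SucI:
  assumes "open N" and "\<And>x. x \<in> N \<Longrightarrow> (f has_derivative f' x) (at x)"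
    and "\<And>v. Ck_on k N (\<lambda>x. f' x v)"
  shows "Ck_on (Suc k) N f"
proof -
  have "Ck_on k N (\<lambda>x. frechet_derivative f (at x) v)" for v
    by (rule Ck_on_cong[OF assms(1) assms(3)[of v]]) (simp add: frechet_derivative_at[OF assms(2)])
  then show ?thesis using assms(2) by (auto simp: differentiable_def)
qed

lemma Ck_on_Suc_has_derivative:
  "Ck_on (Suc k) N f \<Longrightarrow> x \<in> N \<Longrightarrow> (f has_derivative frechet_derivative f (at x)) (at x)"
  by (simp add: frechet_derivative_works)

lemma Ck_on_const: "open N \<Longrightarrow> Ck_on k N (\<lambda>x. c)"
proof (induction k arbitrary: c)
  case (Suc k)
  show ?case by (rule Ck_on_SucI[OF \<open>open N\<close> has_derivative_const]) (rule Suc.IH[OF Suc.prems])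
qed simp

lemma Ck_on_bounded_linear_comp:
  assumes "bounded_linear l" and "open N" and "Ck_on k N f"
  shows "Ck_on k N (\<lambda>x. l (f x))"
  using assms(3)
proof (induction k arbitrary: f)
  case 0
  then show ?case using bounded_linear.continuous_on[OF assms(1)] by auto
next
  case (Suc k)
  show ?case
    by (rule Ck_on_SucI[OF assms(2)
          bounded_linear.has_derivative[OF assms(1) Ck_on_Suc_has_derivative[OF Suc.prems]]])
      (use Suc in auto)
qed

lemma Ck_on_bounded_linear:
  assumes "bounded_linear l" and "open N"
  shows "Ck_on k N l"
proof (cases k)
  case 0
  then show ?thesis using linear_continuous_on[OF assms(1)] by simp
next
  case (Suc j)
  have "Ck_on (Suc j) N l"
    by (rule Ck_on_SucI[OF assms(2) bounded_linear_imp_has_derivative[OF assms(1)]])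
      (rule Ck_on_const[OF assms(2)])
  then show ?thesis using Suc by simp
qed

lemma Ck_on_add:
  assumes "open N" and "Ck_on k N f" and "Ck_on k N g"
  shows "Ck_on k N (\<lambda>x. f x + g x)"
  using assms(2,3)
proof (induction k arbitrary: f g)
  case 0
  then show ?case by (auto intro: continuous_on_add)
next
  case (Suc k)
  show ?case
    by (rule Ck_on_SucI[OF assms(1) has_derivative_add[OF
          Ck_on_Suc_has_derivative[OF Suc.prems(1)] Ck_on_Suc_has_derivative[OF Suc.prems(2)]]])
      (use Suc in auto)
qed

lemma Ck_on_mult:
  fixes f g :: "'a::real_normed_vector \<Rightarrow> real"
  assumes "open N" and "Ck_on k N f" and "Ck_on k N g"
  shows "Ck_on k N (\<lambda>x. f x * g x)"
  using assms(2,3)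
proof (induction k arbitrary: f g)
  case 0
  then show ?case by (auto intro: continuous_on_mult)
next
  case (Suc k)
  show ?case
  proof (rule Ck_on_SucI[OF assms(1) has_derivative_mult[OF
          Ck_on_Suc_has_derivative[OF Suc.prems(1)] Ck_on_Suc_has_derivative[OF Suc.prems(2)]]])
    fix v
    \<comment> \<open>The product rule leaves one factor of each term undifferentiated, so the
      induction hypothesis also needs \<open>f\<close> and \<open>g\<close> themselves at order
      \<open>k\<close>; \<open>Ck_on_Suc_imp\<close> lowers them.\<close>
    show "Ck_on k N (\<lambda>x. f x * frechet_derivative g (at x) v + frechet_derivative f (at x) v * g x)"
      using Suc.prems Suc.prems[THEN Ck_on_Suc_imp] by (intro Ck_on_add[OF assms(1)] Suc.IH) auto
  qed
qed

lemma open_vimage_affine: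
  assumes "bounded_linear l" and "open N"
  shows "open ((\<lambda>x. l x + a) -` N)"
  by (intro continuous_open_vimage assms(2) continuous_intros linear_continuous_at assms(1))

text \<open>The inner map has the constant derivative \<open>l\<close>, so a directional derivative
  of the composition is again a composition of the same shape, and the induction closes without a
  formula for higher derivatives. Affine inner maps cover the two cases that occur: translations of
  \<real>^d and the projection \<open>snd\<close> of a product chart.\<close>

lemma Ck_on_compose_affine:
  assumes l: "bounded_linear l" and "open N" and "Ck_on k N f"
  shows "Ck_on k ((\<lambda>x. l x + a) -` N) (\<lambda>x. f (l x + a))"
  using assms(3)
proof (induction k arbitrary: f)
  case 0
  have "continuous_on ((\<lambda>x. l x + a) -` N) (\<lambda>x. l x + a)"
    by (intro continuous_intros linear_continuous_on l)
  then show ?case using 0 continuous_on_compose2[of N f] by fastforce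
next
  case (Suc k)
  have o: "open ((\<lambda>x. l x + a) -` N)"
    by (rule open_vimage_affine[OF l assms(2)])
  have a: "((\<lambda>x. l x + a) has_derivative l) (at x)" for x
    using has_derivative_add_const[OF bounded_linear_imp_has_derivative[OF l]] .
  show ?case
    by (rule Ck_on_SucI[OF o has_derivative_compose[OF a Ck_on_Suc_has_derivative[OF Suc.prems]]])
      (use Suc in auto)
qed

section \<open>Smooth functions on arbitrary subsets\<close>

definition Cinf_on :: "'a::real_normed_vector set \<Rightarrow> ('a \<Rightarrow> 'b::real_normed_vector) \<Rightarrow> bool" where
  "Cinf_on N f \<longleftrightarrow> (\<forall>k. Ck_on k N f)"

lemma smooth_on_alt:
  "smooth_on S f \<longleftrightarrow> (\<forall>x\<in>S. \<exists>N g. open N \<and> x \<in> N \<and> Cinf_on N g \<and> (\<forall>y\<in>N \<inter> S. g y = f y))"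
  by (simp add: smooth_on_def Cinf_on_def)

lemma smooth_onE:
  assumes "smooth_on S f" and "x \<in> S"
  obtains N g where "open N" and "x \<in> N" and "Cinf_on N g" and "\<forall>y\<in>N \<inter> S. g y = f y"
  using bspec[OF assms(1)[unfolded smooth_on_alt] assms(2)] by (elim exE conjE)

lemma smooth_onI:
  assumes "open N" and "Cinf_on N g" and "S \<subseteq> N" and "\<And>y. y \<in> S \<Longrightarrow> g y = f y"
  shows "smooth_on S f"
  unfolding smooth_on_alt using assms by (intro ballI exI[of _ N] exI[of _ g]) auto

lemma smooth_on_subset:
  assumes "smooth_on S f" and "T \<subseteq> S"
  shows "smooth_on T f"
  unfolding smooth_on_alt
proof
  fix x assume "x \<in> T"
  then have "x \<in> S" using assms(2) by blast
  with assms(1) obtain N g where "open N" "x \<in> N" "Cinf_on N g" "\<forall>y\<in>N \<inter> S. g y = f y"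
    by (rule smooth_onE)
  then show "\<exists>N g. open N \<and> x \<in> N \<and> Cinf_on N g \<and> (\<forall>y\<in>N \<inter> T. g y = f y)"
    using assms(2) by (intro exI[of _ N] exI[of _ g]) auto
qed

lemma smooth_on_transform:
  assumes "smooth_on S f" and "\<And>x. x \<in> S \<Longrightarrow> f x = g x"
  shows "smooth_on S g"
  unfolding smooth_on_alt
proof
  fix x assume "x \<in> S"
  with assms(1) obtain N h where "open N" "x \<in> N" "Cinf_on N h" "\<forall>y\<in>N \<inter> S. h y = f y"
    by (rule smooth_onE)
  then show "\<exists>N h. open N \<and> x \<in> N \<and> Cinf_on N h \<and> (\<forall>y\<in>N \<inter> S. h y = g y)"
    using assms(2) by (intro exI[of _ N] exI[of _ h]) auto
qed

text \<open>Only the local extension \<open>g\<close> is claimed to be differentiable: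
  \<open>S\<close> can have empty interior, since charts take values in a subspace, and then
  \<open>f\<close> itself need not be differentiable at \<open>x\<close>.\<close>

lemma smooth_on_differentiable:
  assumes "smooth_on S f" and "x \<in> S"
  obtains N g where "open N" "x \<in> N" "g differentiable at x" "\<forall>y\<in>N \<inter> S. g y = f y"
proof -
  from assms obtain N g where N: "open N" "x \<in> N" "Cinf_on N g" "\<forall>y\<in>N \<inter> S. g y = f y"
    by (rule smooth_onE)
  have "Ck_on (Suc 0) N g" using N(3) by (simp only: Cinf_on_def)
  then have "g differentiable at x" using N(2) by simp
  with N show ?thesis by (intro that)
qed

lemma smooth_on_lincomb:
  fixes f g :: "'a::real_normed_vector \<Rightarrow> real"
  assumes "smooth_on S f" and "smooth_on S g"
  shows "smooth_on S (\<lambda>x. a * f x + b * g x)"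
  unfolding smooth_on_alt
proof
  fix x assume x: "x \<in> S"
  from assms(1) x obtain N f' where N: "open N" "x \<in> N" "Cinf_on N f'" "\<forall>y\<in>N \<inter> S. f' y = f y"
    by (rule smooth_onE)
  from assms(2) x obtain N' g' where N': "open N'" "x \<in> N'" "Cinf_on N' g'" "\<forall>y\<in>N' \<inter> S. g' y = g y"
    by (rule smooth_onE)
  have o: "open (N \<inter> N')" using N N' by blast
  have f: "Ck_on k N f'" and g: "Ck_on k N' g'" for k
    using N(3) N'(3) by (simp_all add: Cinf_on_def)
  have "Ck_on k (N \<inter> N') (\<lambda>x. a * f' x + b * g' x)" for k
    by (intro Ck_on_add[OF o] Ck_on_mult[OF o] Ck_on_const[OF o] Ck_on_subset[OF f] Ck_on_subset[OF g]) auto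
  then have "Cinf_on (N \<inter> N') (\<lambda>x. a * f' x + b * g' x)" by (simp add: Cinf_on_def)
  with o N N' show "\<exists>M h. open M \<and> x \<in> M \<and> Cinf_on M h \<and> (\<forall>y\<in>M \<inter> S. h y = a * f y + b * g y)"
    by (intro exI[of _ "N \<inter> N'"] exI[of _ "\<lambda>x. a * f' x + b * g' x"]) auto
qed

lemma smooth_on_mult:
  fixes f g :: "'a::real_normed_vector \<Rightarrow> real"
  assumes "smooth_on S f" and "smooth_on S g"
  shows "smooth_on S (\<lambda>x. f x * g x)"
  unfolding smooth_on_alt
proof
  fix x assume x: "x \<in> S"
  from assms(1) x obtain N f' where N: "open N" "x \<in> N" "Cinf_on N f'" "\<forall>y\<in>N \<inter> S. f' y = f y"
    by (rule smooth_onE)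
  from assms(2) x obtain N' g' where N': "open N'" "x \<in> N'" "Cinf_on N' g'" "\<forall>y\<in>N' \<inter> S. g' y = g y"
    by (rule smooth_onE)
  have o: "open (N \<inter> N')" using N N' by blast
  have f: "Ck_on k N f'" and g: "Ck_on k N' g'" for k
    using N(3) N'(3) by (simp_all add: Cinf_on_def)
  have "Ck_on k (N \<inter> N') (\<lambda>x. f' x * g' x)" for k
    by (intro Ck_on_mult[OF o] Ck_on_subset[OF f] Ck_on_subset[OF g]) auto
  then have "Cinf_on (N \<inter> N') (\<lambda>x. f' x * g' x)" by (simp add: Cinf_on_def)
  with o N N' show "\<exists>M h. open M \<and> x \<in> M \<and> Cinf_on M h \<and> (\<forall>y\<in>M \<inter> S. h y = f y * g y)"
    by (intro exI[of _ "N \<inter> N'"] exI[of _ "\<lambda>x. f' x * g' x"]) auto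
qed

lemma smooth_on_bounded_linear_comp:
  assumes "bounded_linear l" and "smooth_on S f"
  shows "smooth_on S (\<lambda>x. l (f x))"
  unfolding smooth_on_alt
proof
  fix x assume "x \<in> S"
  with assms(2) obtain N g where N: "open N" "x \<in> N" "Cinf_on N g" "\<forall>y\<in>N \<inter> S. g y = f y"
    by (rule smooth_onE)
  then have "Cinf_on N (\<lambda>x. l (g x))"
    by (simp add: Cinf_on_def Ck_on_bounded_linear_comp[OF assms(1)])
  with N show "\<exists>M h. open M \<and> x \<in> M \<and> Cinf_on M h \<and> (\<forall>y\<in>M \<inter> S. h y = l (f y))"
    by (intro exI[of _ N] exI[of _ "\<lambda>x. l (g x)"]) auto
qed

lemma smooth_on_compose_affine:
  assumes "bounded_linear l" and "smooth_on S f"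
  shows "smooth_on ((\<lambda>x. l x + a) -` S) (\<lambda>x. f (l x + a))"
  unfolding smooth_on_alt
proof
  fix x assume "x \<in> (\<lambda>x. l x + a) -` S"
  then have "l x + a \<in> S" by simp
  with assms(2) obtain N g where N: "open N" "l x + a \<in> N" "Cinf_on N g" "\<forall>y\<in>N \<inter> S. g y = f y"
    by (rule smooth_onE)
  let ?N = "(\<lambda>x. l x + a) -` N"
  have "Cinf_on ?N (\<lambda>x. g (l x + a))"
    using N by (simp add: Cinf_on_def Ck_on_compose_affine[OF assms(1)])
  moreover have "open ?N"
    by (rule open_vimage_affine[OF assms(1) N(1)])
  ultimately show "\<exists>M h. open M \<and> x \<in> M \<and> Cinf_on M h \<and>
      (\<forall>y\<in>M \<inter> (\<lambda>x. l x + a) -` S. h y = f (l y + a))"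
    using N by (intro exI[of _ ?N] exI[of _ "\<lambda>x. g (l x + a)"]) auto
qed

section \<open>Locally smooth functions on manifolds\<close>

definition smooth_in_charts :: "('a, 'v::euclidean_space) manifold \<Rightarrow> 'a set \<Rightarrow> ('a \<Rightarrow> real) \<Rightarrow> bool" where
  "smooth_in_charts M W f \<longleftrightarrow>
     (\<forall>D \<phi>. (D, \<phi>) \<in> atlas M \<longrightarrow> smooth_on (\<phi> ` (D \<inter> W)) (f \<circ> inv_into D \<phi>))"

lemma smooth_in_chartsI:
  "(\<And>D \<phi>. (D, \<phi>) \<in> atlas M \<Longrightarrow> smooth_on (\<phi> ` (D \<inter> W)) (f \<circ> inv_into D \<phi>)) \<Longrightarrow>
    smooth_in_charts M W f"
  by (simp add: smooth_in_charts_def)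

lemma smooth_in_chartsD:
  "smooth_in_charts M W f \<Longrightarrow> (D, \<phi>) \<in> atlas M \<Longrightarrow> smooth_on (\<phi> ` (D \<inter> W)) (f \<circ> inv_into D \<phi>)"
  by (simp add: smooth_in_charts_def)

lemma smooth_near_alt:
  "smooth_near M p f \<longleftrightarrow> (\<exists>W. openin (man_top M) W \<and> p \<in> W \<and> smooth_in_charts M W f)"
proof -
  have "(\<forall>(D, \<phi>)\<in>A. P D \<phi>) \<longleftrightarrow> (\<forall>D \<phi>. (D, \<phi>) \<in> A \<longrightarrow> P D \<phi>)"
    for A :: "('a set \<times> ('a \<Rightarrow> 'b)) set" and P by auto
  then show ?thesis unfolding smooth_near_def smooth_in_charts_def o_def by (simp only:)
qed

lemma smooth_in_charts_subset: "smooth_in_charts M W f \<Longrightarrow> V \<subseteq> W \<Longrightarrow> smooth_in_charts M V f"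
  by (rule smooth_in_chartsI, rule smooth_on_subset[OF smooth_in_chartsD]) auto

lemma smooth_in_charts_lincomb:
  "smooth_in_charts M W f \<Longrightarrow> smooth_in_charts M W g \<Longrightarrow> smooth_in_charts M W (\<lambda>q. a * f q + b * g q)"
  by (simp add: smooth_in_charts_def smooth_on_lincomb o_def)

lemma smooth_in_charts_mult:
  "smooth_in_charts M W f \<Longrightarrow> smooth_in_charts M W g \<Longrightarrow> smooth_in_charts M W (\<lambda>q. f q * g q)"
  by (simp add: smooth_in_charts_def smooth_on_mult o_def)

lemma smooth_near_lincomb:
  assumes "smooth_near M p f" and "smooth_near M p g"
  shows "smooth_near M p (\<lambda>q. a * f q + b * g q)"
proof -
  from assms obtain W V where "openin (man_top M) W" "p \<in> W" "smooth_in_charts M W f"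
    and "openin (man_top M) V" "p \<in> V" "smooth_in_charts M V g"
    unfolding smooth_near_alt by blast
  then show ?thesis
    unfolding smooth_near_alt
    by (intro exI[of _ "W \<inter> V"] conjI smooth_in_charts_lincomb openin_Int)
      (auto intro: smooth_in_charts_subset)
qed

lemma smooth_near_mult:
  assumes "smooth_near M p f" and "smooth_near M p g"
  shows "smooth_near M p (\<lambda>q. f q * g q)"
proof -
  from assms obtain W V where "openin (man_top M) W" "p \<in> W" "smooth_in_charts M W f"
    and "openin (man_top M) V" "p \<in> V" "smooth_in_charts M V g"
    unfolding smooth_near_alt by blast
  then show ?thesis
    unfolding smooth_near_alt
    by (intro exI[of _ "W \<inter> V"] conjI smooth_in_charts_mult openin_Int)
      (auto intro: smooth_in_charts_subset)
qed

lemma chart_inj_on: "topological_chart M D \<phi> \<Longrightarrow> inj_on \<phi> D"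
  using openin_subset[of "man_top M" D]
  by (auto simp: topological_chart_def homeomorphic_map_def Int_absorb1)

text \<open>The chart expressions of \<open>f\<close> and \<open>g\<close> agree on the image of a
  smaller neighbourhood, because a chart is injective and \<open>inv_into\<close> therefore returns
  to \<open>V\<close>.\<close>

lemma smooth_near_cong:
  assumes "smooth_manifold M" and "openin (man_top M) V" and "p \<in> V" and "\<And>q. q \<in> V \<Longrightarrow> f q = g q"
    and "smooth_near M p f"
  shows "smooth_near M p g"
proof -
  from assms(5) obtain W where
    W: "openin (man_top M) W" "p \<in> W" "smooth_in_charts M W f"
    unfolding smooth_near_alt by blast
  have "smooth_in_charts M (W \<inter> V) g"
  proof (rule smooth_in_chartsI)
    fix D \<phi> assume D: "(D, \<phi>) \<in> atlas M"
    have "topological_chart M D \<phi>" using assms(1) D by (auto simp: smooth_manifold_def)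
    then have inj: "inj_on \<phi> D" by (rule chart_inj_on)
    have "smooth_on (\<phi> ` (D \<inter> (W \<inter> V))) (f \<circ> inv_into D \<phi>)"
      by (rule smooth_on_subset[OF smooth_in_chartsD[OF W(3) D]]) auto
    then show "smooth_on (\<phi> ` (D \<inter> (W \<inter> V))) (g \<circ> inv_into D \<phi>)"
      by (rule smooth_on_transform) (use assms(4) inj in auto)
  qed
  then show ?thesis using W(1,2) assms(2,3) unfolding smooth_near_alt by blast
qed

section \<open>Local smoothness in Euclidean spaces, under smooth maps and on products\<close>

lemma smooth_near_euclidean_iff:
  "smooth_near euclidean_manifold x f \<longleftrightarrow> (\<exists>N. open N \<and> x \<in> N \<and> smooth_on N f)"
  by (simp add: smooth_near_def euclidean_manifold_def flip: open_openin)

lemma smooth_near_euclidean_bounded_linear: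
  assumes "bounded_linear f"
  shows "smooth_near euclidean_manifold x f"
proof -
  have "Cinf_on UNIV f" by (simp add: Cinf_on_def Ck_on_bounded_linear[OF assms])
  then have "smooth_on UNIV f" by (rule smooth_onI[OF open_UNIV]) auto
  then show ?thesis unfolding smooth_near_euclidean_iff by blast
qed

lemma smooth_near_euclidean_translate:
  assumes "smooth_near euclidean_manifold (x + a) f"
  shows "smooth_near euclidean_manifold x (\<lambda>y. f (y + a))"
proof -
  from assms obtain N where N: "open N" "x + a \<in> N" "smooth_on N f"
    unfolding smooth_near_euclidean_iff by blast
  have "open ((\<lambda>y. y + a) -` N)"
    by (rule open_vimage_affine[OF bounded_linear_ident N(1)])
  then show ?thesis
    using N smooth_on_compose_affine[OF bounded_linear_ident N(3), of a]
    unfolding smooth_near_euclidean_iff by blast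
qed

lemma smooth_near_euclidean_differentiable:
  assumes "smooth_near euclidean_manifold x f"
  shows "f differentiable at x"
proof -
  from assms obtain N where N: "open N" "x \<in> N" "smooth_on N f"
    unfolding smooth_near_euclidean_iff by blast
  from smooth_on_differentiable[OF N(3,2)] obtain N' g where
    N': "open N'" "x \<in> N'" "g differentiable at x" "\<forall>y\<in>N' \<inter> N. g y = f y" .
  have "open (N' \<inter> N)" "x \<in> N' \<inter> N" using N N' by auto
  then show ?thesis
    using N'(3,4) unfolding differentiable_def by (metis has_derivative_transform_within_open)
qed

lemma smooth_map_smooth_near:
  "smooth_map M N W K \<Longrightarrow> p \<in> W \<Longrightarrow> smooth_near N (K p) f \<Longrightarrow> smooth_near M p (\<lambda>q. f (K q))"
  by (auto simp: smooth_map_def)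

lemma smooth_map_in_points:
  "smooth_map M N W K \<Longrightarrow> p \<in> W \<Longrightarrow> K p \<in> points N"
  by (auto simp: smooth_map_def continuous_map_def dest: openin_subset)

text \<open>In a product chart, \<open>f \<circ> snd\<close> is the chart expression of
  \<open>f\<close> precomposed with the linear map \<open>snd\<close>. This is what makes the group
  coordinate of a trivialization smooth.\<close>

lemma smooth_near_snd:
  assumes M: "smooth_manifold M" and N: "smooth_manifold N" and "p \<in> points M" and "smooth_near N q f"
  shows "smooth_near (product_manifold M N) (p, q) (\<lambda>x. f (snd x))"
proof -
  from assms(4) obtain W where
    W: "openin (man_top N) W" "q \<in> W" "smooth_in_charts N W f"
    unfolding smooth_near_alt by blast
  have "smooth_in_charts (product_manifold M N) (points M \<times> W) (\<lambda>x. f (snd x))"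
  proof (rule smooth_in_chartsI)
    fix E \<rho> assume "(E, \<rho>) \<in> atlas (product_manifold M N)"
    then obtain D \<phi> D' \<psi> where E: "E = D \<times> D'" "\<rho> = map_prod \<phi> \<psi>" "(D, \<phi>) \<in> atlas M" "(D', \<psi>) \<in> atlas N"
      by (auto simp: product_manifold_def)
    have "topological_chart M D \<phi>" "topological_chart N D' \<psi>"
      using M N E by (auto simp: smooth_manifold_def)
    then have inj: "inj_on \<phi> D" "inj_on \<psi> D'" by (auto intro: chart_inj_on)
    then have injp: "inj_on (map_prod \<phi> \<psi>) (D \<times> D')" by (rule map_prod_inj_on)
    let ?S = "map_prod \<phi> \<psi> ` ((D \<times> D') \<inter> (points M \<times> W))"
    \<comment> \<open>The summand 0 matches the affine form \<open>l x + a\<close>, used with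
      \<open>l = snd\<close> and \<open>a = 0\<close>.\<close>
    have eq: "(f \<circ> inv_into D' \<psi>) (snd x + 0) = ((\<lambda>x. f (snd x)) \<circ> inv_into (D \<times> D') (map_prod \<phi> \<psi>)) x" if "x \<in> ?S" for x
    proof -
      from that obtain d d' where d: "x = map_prod \<phi> \<psi> (d, d')" "d \<in> D" "d' \<in> D'" by auto
      then show ?thesis using inv_into_f_f[OF injp, of "(d, d')"] inj by simp
    qed
    from smooth_on_compose_affine[OF bounded_linear_snd smooth_in_chartsD[OF W(3) E(4)], where a = 0]
    have "smooth_on ?S (\<lambda>x. (f \<circ> inv_into D' \<psi>) (snd x + 0))" by (rule smooth_on_subset) auto
    then show "smooth_on (\<rho> ` (E \<inter> (points M \<times> W))) ((\<lambda>x. f (snd x)) \<circ> inv_into E \<rho>)"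
      unfolding E(1,2) by (rule smooth_on_transform[OF _ eq])
  qed
  moreover have "openin (man_top (product_manifold M N)) (points M \<times> W)"
    using W(1) by (simp add: product_manifold_def openin_prod_Times_iff)
  ultimately show ?thesis using W(2) assms(3) unfolding smooth_near_alt by blast
qed

section \<open>Differentiable curves\<close>

text \<open>The point \<open>s\<close> itself is included, hence \<open>nhds s\<close> with an
  implication instead of the filter \<open>at s within I\<close>: replacing a function under a
  derivative requires agreement at \<open>s\<close> too.\<close>

lemma differentiable_curve_eventually:
  assumes "differentiable_curve M I c" and "s \<in> I" and "openin (man_top M) W" and "c s \<in> W"
  shows "eventually (\<lambda>r. r \<in> I \<longrightarrow> c r \<in> W) (nhds s)"
proof -
  have "openin (top_of_set I) {r \<in> I. c r \<in> W}"
    using assms openin_continuous_map_preimage[of "top_of_set I" "man_top M" c W]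
    by (simp add: differentiable_curve_def)
  then obtain T where T: "open T" "{r \<in> I. c r \<in> W} = I \<inter> T" by (auto simp: openin_open)
  then have "s \<in> T" "\<forall>r\<in>T. r \<in> I \<longrightarrow> c r \<in> W" using assms(2,4) by auto
  with T(1) show ?thesis unfolding eventually_nhds by blast
qed

lemma differentiable_curve_in_points:
  assumes "differentiable_curve M I c" and "s \<in> I"
  shows "c s \<in> points M"
  using assms continuous_map_image_subset_topspace[of "top_of_set I" "man_top M" c]
  by (auto simp: differentiable_curve_def)

lemma differentiable_curve_smooth_near:
  "differentiable_curve M I c \<Longrightarrow> s \<in> I \<Longrightarrow> smooth_near M (c s) f \<Longrightarrow>
    (\<lambda>r. f (c r)) differentiable (at s within I)"
  by (simp add: differentiable_curve_def)

lemma differentiable_within_transform: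
  assumes "f differentiable (at s within I)" and "s \<in> I"
    and "eventually (\<lambda>r. r \<in> I \<longrightarrow> f r = g r) (nhds s)"
  shows "g differentiable (at s within I)"
proof -
  from assms(1) obtain f' where "(f has_derivative f') (at s within I)" unfolding differentiable_def ..
  moreover have "eventually (\<lambda>r. f r = g r) (at s within I)"
    unfolding eventually_at_filter using assms(3) by (rule eventually_mono) simp
  moreover have "f s = g s" using assms(2,3) eventually_nhds_x_imp_x by blast
  ultimately have "(g has_derivative f') (at s within I)"
    by (rule has_derivative_transform_eventually) (use assms(2) in auto)
  then show ?thesis unfolding differentiable_def by blast
qed

lemma differentiable_curve_cong:
  assumes "differentiable_curve M I c" and "\<And>r. r \<in> I \<Longrightarrow> c r = c' r"
  shows "differentiable_curve M I c'"
  unfolding differentiable_curve_def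
proof (intro conjI ballI allI impI)
  show "continuous_map (top_of_set I) (man_top M) c'"
    using assms by (auto simp: differentiable_curve_def intro: continuous_map_eq)
  fix s f assume s: "s \<in> I" "smooth_near M (c' s) f"
  have "(\<lambda>r. f (c r)) differentiable (at s within I)"
    using assms s by (intro differentiable_curve_smooth_near) auto
  then show "(\<lambda>r. f (c' r)) differentiable (at s within I)"
    by (rule differentiable_within_transform) (use assms(2) s in auto)
qed

lemma velocity_cong:
  assumes "s \<in> I" and "\<And>r. r \<in> I \<Longrightarrow> c r = c' r"
  shows "velocity M I c s = velocity M I c' s"
proof -
  have "vector_derivative (\<lambda>r. f (c r)) (at s within I) = vector_derivative (\<lambda>r. f (c' r)) (at s within I)"
    for f :: "'a \<Rightarrow> real"
    by (rule vector_derivative_cong_eq) (use assms in auto)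
  then show ?thesis unfolding velocity_def assms(2)[OF assms(1)] by (intro ext if_cong refl)
qed

text \<open>The premise on \<open>at s within I\<close> makes the derivative within \<open>I\<close>
  unique, so the sum and product rules turn into the linearity and Leibniz conditions. Locality
  holds because the curve stays in the given open set near \<open>s\<close>.\<close>

lemma velocity_in_tangent_space:
  assumes c: "differentiable_curve M I c" and s: "s \<in> I" and lim: "at s within I \<noteq> bot"
  shows "velocity M I c s \<in> tangent_space M (c s)"
proof -
  define d where "d f = vector_derivative (\<lambda>r. f (c r)) (at s within I)" for f :: "'a \<Rightarrow> real"
  have vd: "((\<lambda>r. f (c r)) has_vector_derivative d f) (at s within I)" if "smooth_near M (c s) f" for f
    using differentiable_curve_smooth_near[OF c s that] by (simp add: d_def vector_derivative_works)
  have dI: "d f = f'" if "((\<lambda>r. f (c r)) has_vector_derivative f') (at s within I)" for f f'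
    unfolding d_def using that lim by (simp add: vector_derivative_within)
  have "d (\<lambda>q. a * f q + b * g q) = a * d f + b * d g"
    if "smooth_near M (c s) f" "smooth_near M (c s) g" for f g a b
    by (rule dI) (intro has_vector_derivative_add has_vector_derivative_mult_right vd that)
  moreover have "d (\<lambda>q. f q * g q) = f (c s) * d g + g (c s) * d f"
    if "smooth_near M (c s) f" "smooth_near M (c s) g" for f g
    using dI[OF has_vector_derivative_mult[OF vd[OF that(1)] vd[OF that(2)]]] by (simp add: mult.commute)
  moreover have "d f = d g" if "openin (man_top M) W" "c s \<in> W" "\<forall>q\<in>W. f q = g q" for f g W
    unfolding d_def using differentiable_curve_eventually[OF c s that(1,2)] that(3) s
    by (intro vector_derivative_cong_eq) (auto elim!: eventually_mono)
  moreover have "velocity M I c s f = (if smooth_near M (c s) f then d f else 0)" for f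
    by (simp add: velocity_def d_def)
  ultimately show ?thesis
    unfolding tangent_space_def by (simp add: smooth_near_lincomb smooth_near_mult) metis
qed

text \<open>Smooth maps are defined by pullback, so testing \<open>K \<circ> c\<close> with
  \<open>f\<close> is testing \<open>c\<close> with \<open>f \<circ> K\<close>; neither charts nor a
  chain rule are involved.\<close>

lemma smooth_map_curve:
  assumes K: "smooth_map M N W K" and c: "differentiable_curve M I c" and cW: "\<And>r. r \<in> I \<Longrightarrow> c r \<in> W"
  shows "differentiable_curve N I (\<lambda>r. K (c r))"
  unfolding differentiable_curve_def
proof (intro conjI ballI allI impI)
  have "continuous_map (top_of_set I) (subtopology (man_top M) W) c"
    using c cW by (auto simp: differentiable_curve_def continuous_map_in_subtopology)
  then have "continuous_map (top_of_set I) (man_top N) (K \<circ> c)"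
    using K by (auto simp: smooth_map_def intro: continuous_map_compose)
  then show "continuous_map (top_of_set I) (man_top N) (\<lambda>r. K (c r))" by (simp add: o_def)
  fix s f assume s: "s \<in> I" and "smooth_near N (K (c s)) f"
  then have "smooth_near M (c s) (\<lambda>q. f (K q))" by (intro smooth_map_smooth_near[OF K] cW)
  from differentiable_curve_smooth_near[OF c s this]
  show "(\<lambda>r. f (K (c r))) differentiable (at s within I)" .
qed

lemma velocity_pushforward:
  assumes K: "smooth_map M N W K" and "c s \<in> W"
  shows "pushforward N (K (c s)) K (velocity M I c s) = velocity N I (\<lambda>r. K (c r)) s"
  using smooth_map_smooth_near[OF assms] by (auto simp: pushforward_def velocity_def)

text \<open>The components of a chart are themselves test functions, since the transitions from all
  charts of the atlas are smooth. Differentiability in the sense of test functions thus yields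
  differentiability of the coordinates.\<close>

lemma chart_curve_differentiable:
  assumes M: "smooth_manifold M" and D: "(D, \<phi>) \<in> atlas M"
    and c: "differentiable_curve M I c" and s: "s \<in> I" "c s \<in> D"
  shows "(\<lambda>r. \<phi> (c r)) differentiable (at s within I)"
proof -
  have o: "openin (man_top M) D"
    using M D by (auto simp: smooth_manifold_def topological_chart_def)
  have near: "smooth_near M (c s) (\<lambda>q. \<phi> q \<bullet> b)" for b
  proof -
    have "smooth_in_charts M D (\<lambda>q. \<phi> q \<bullet> b)"
    proof (rule smooth_in_chartsI)
      fix D' \<phi>' assume "(D', \<phi>') \<in> atlas M"
      then have "smooth_transition D' \<phi>' D \<phi>" using M D by (auto simp: smooth_manifold_def)
      then have "smooth_on (\<phi>' ` (D' \<inter> D)) (\<lambda>x. \<phi> (inv_into D' \<phi>' x))"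
        by (simp add: smooth_transition_def)
      from smooth_on_bounded_linear_comp[OF bounded_linear_inner_left this]
      show "smooth_on (\<phi>' ` (D' \<inter> D)) ((\<lambda>q. \<phi> q \<bullet> b) \<circ> inv_into D' \<phi>')" by (simp add: o_def)
    qed
    then show ?thesis using o s(2) unfolding smooth_near_alt by blast
  qed
  show ?thesis
    unfolding differentiable_componentwise_within[of "\<lambda>r. \<phi> (c r)"]
    using differentiable_curve_smooth_near[OF c s(1) near] by blast
qed

text \<open>A test function on the product involves both variables at once and cannot be reduced to
  test functions on the factors. In a product chart it extends to a function \<open>g\<close> that
  is differentiable at the point in question, and the coordinate curve is a pair of differentiable
  curves, so the ordinary chain rule applies.\<close>

lemma product_curve:
  assumes M: "smooth_manifold M" and N: "smooth_manifold N"
    and c: "differentiable_curve M I c" and c': "differentiable_curve N I c'"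
  shows "differentiable_curve (product_manifold M N) I (\<lambda>r. (c r, c' r))"
  unfolding differentiable_curve_def
proof (intro conjI ballI allI impI)
  let ?P = "product_manifold M N"
  show "continuous_map (top_of_set I) (man_top ?P) (\<lambda>r. (c r, c' r))"
    using c c' by (simp add: differentiable_curve_def product_manifold_def continuous_map_paired)
  fix s f assume s: "s \<in> I" and "smooth_near ?P (c s, c' s) f"
  then obtain W where W: "openin (man_top ?P) W" "(c s, c' s) \<in> W" "smooth_in_charts ?P W f"
    unfolding smooth_near_alt by blast
  have "c s \<in> points M" "c' s \<in> points N" using c c' s by (auto intro: differentiable_curve_in_points)
  moreover have "(\<Union>(D, \<phi>)\<in>atlas M. D) = points M" "(\<Union>(D, \<phi>)\<in>atlas N. D) = points N"
    using M N by (simp_all add: smooth_manifold_def)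
  ultimately obtain D \<phi> D' \<phi>' where
    D: "(D, \<phi>) \<in> atlas M" "c s \<in> D" and D': "(D', \<phi>') \<in> atlas N" "c' s \<in> D'" by blast
  let ?E = "D \<times> D'" and ?\<rho> = "map_prod \<phi> \<phi>'"
  have "topological_chart M D \<phi>" "topological_chart N D' \<phi>'"
    using M N D(1) D'(1) by (auto simp: smooth_manifold_def)
  then have inj: "inj_on \<phi> D" "inj_on \<phi>' D'" and o: "openin (man_top M) D" "openin (man_top N) D'"
    by (auto intro: chart_inj_on simp: topological_chart_def)
  have injp: "inj_on ?\<rho> ?E" using inj by (rule map_prod_inj_on)
  have "(?E, ?\<rho>) \<in> atlas ?P" using D(1) D'(1) by (auto simp: product_manifold_def)
  with W(3) have "smooth_on (?\<rho> ` (?E \<inter> W)) (f \<circ> inv_into ?E ?\<rho>)" by (rule smooth_in_chartsD)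
  moreover have "?\<rho> (c s, c' s) \<in> ?\<rho> ` (?E \<inter> W)" using W(2) D(2) D'(2) by blast
  ultimately obtain T g where T: "open T" "?\<rho> (c s, c' s) \<in> T" "g differentiable at (?\<rho> (c s, c' s))"
    "\<forall>y\<in>T \<inter> ?\<rho> ` (?E \<inter> W). g y = (f \<circ> inv_into ?E ?\<rho>) y"
    by (rule smooth_on_differentiable)
  have d: "(\<lambda>r. \<phi> (c r)) differentiable (at s within I)" "(\<lambda>r. \<phi>' (c' r)) differentiable (at s within I)"
    using chart_curve_differentiable[OF M D(1) c s D(2)] chart_curve_differentiable[OF N D'(1) c' s D'(2)] .
  have dp: "(\<lambda>r. (\<phi> (c r), \<phi>' (c' r))) differentiable (at s within I)"
  proof -
    from d obtain d1 d2 where "((\<lambda>r. \<phi> (c r)) has_derivative d1) (at s within I)"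
      "((\<lambda>r. \<phi>' (c' r)) has_derivative d2) (at s within I)"
      unfolding differentiable_def by blast
    from has_derivative_Pair[OF this] show ?thesis unfolding differentiable_def by blast
  qed
  have g: "(\<lambda>r. g (\<phi> (c r), \<phi>' (c' r))) differentiable (at s within I)"
    using differentiable_compose[OF _ dp, of g] T(3) by (simp add: differentiable_at_withinI)
  have ev1: "eventually (\<lambda>r. r \<in> I \<longrightarrow> (\<phi> (c r), \<phi>' (c' r)) \<in> T) (nhds s)"
  proof -
    have "continuous (at s within I) (\<lambda>r. (\<phi> (c r), \<phi>' (c' r)))"
      using dp by (rule differentiable_imp_continuous_within)
    then have "eventually (\<lambda>r. (\<phi> (c r), \<phi>' (c' r)) \<in> T) (at s within I)"
      using T(1,2) by (auto simp: continuous_within dest: topological_tendstoD)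
    then show ?thesis unfolding eventually_at_filter
      by (rule eventually_mono) (use T(2) in auto)
  qed
  have ev2: "eventually (\<lambda>r. r \<in> I \<longrightarrow> (c r, c' r) \<in> W) (nhds s)"
  proof -
    have "openin (prod_topology (man_top M) (man_top N)) W"
      using W(1) by (simp add: product_manifold_def)
    with W(2) obtain V V' where V: "openin (man_top M) V" "openin (man_top N) V'" "c s \<in> V" "c' s \<in> V'"
      "V \<times> V' \<subseteq> W"
      using openin_prod_topology_alt[of "man_top M" "man_top N" W] by metis
    from differentiable_curve_eventually[OF c s V(1,3)] differentiable_curve_eventually[OF c' s V(2,4)]
    show ?thesis by eventually_elim (use V(5) in auto)
  qed
  \<comment> \<open>Agreement of \<open>g\<close> and \<open>f\<close> along the curve is needed
    only near \<open>s\<close>: there the curve stays in \<open>W\<close> and in both chart domains,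
    and its coordinates stay in \<open>T\<close>.\<close>
  have "eventually (\<lambda>r. r \<in> I \<longrightarrow> g (\<phi> (c r), \<phi>' (c' r)) = f (c r, c' r)) (nhds s)"
    using ev1 ev2 differentiable_curve_eventually[OF c s o(1) D(2)]
      differentiable_curve_eventually[OF c' s o(2) D'(2)]
  proof eventually_elim
    case (elim r)
    show ?case
    proof
      assume "r \<in> I"
      then have r: "(c r, c' r) \<in> ?E \<inter> W" "?\<rho> (c r, c' r) \<in> T" using elim by auto
      then have "g (?\<rho> (c r, c' r)) = f (inv_into ?E ?\<rho> (?\<rho> (c r, c' r)))" using T(4) by auto
      also have "\<dots> = f (c r, c' r)" using inv_into_f_f[OF injp] r(1) by auto
      finally show "g (\<phi> (c r), \<phi>' (c' r)) = f (c r, c' r)" by simp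
    qed
  qed
  with g s show "(\<lambda>r. f (c r, c' r)) differentiable (at s within I)"
    by (intro differentiable_within_transform[OF g])
qed

lemma differentiable_euclidean_curve:
  assumes "\<And>s. s \<in> I \<Longrightarrow> C differentiable (at s within I)"
  shows "differentiable_curve euclidean_manifold I C"
  unfolding differentiable_curve_def
proof (intro conjI ballI allI impI)
  have "continuous_on I C"
    using assms by (simp add: continuous_on_eq_continuous_within differentiable_imp_continuous_within)
  then show "continuous_map (top_of_set I) (man_top euclidean_manifold) C"
    by (simp add: euclidean_manifold_def)
  fix s f assume s: "s \<in> I" "smooth_near euclidean_manifold (C s) f"
  then have "f differentiable (at (C s))" by (intro smooth_near_euclidean_differentiable)
  from differentiable_compose[OF this assms[OF s(1)]]
  show "(\<lambda>r. f (C r)) differentiable (at s within I)" .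
qed

section \<open>Lie groups isomorphic to \<open>\<real>\<^sup>d\<close>\<close>

lemma smooth_euclidean_component:
  "smooth_near euclidean_manifold x (\<lambda>y :: real ^ 'd. y $ b)"
  by (rule smooth_near_euclidean_bounded_linear) (rule bounded_linear_vec_nth)

lemma differentiable_within_vecI:
  fixes C :: "real \<Rightarrow> real ^ 'd"
  assumes "\<And>b. (\<lambda>r. C r $ b) differentiable (at s within I)"
  shows "C differentiable (at s within I)"
  unfolding differentiable_componentwise_within[of C]
  using assms by (auto simp: Basis_vec_def inner_axis)

locale lie_group_Rn =
  fixes G :: "('h, 'w::euclidean_space) lie_grp" and \<Phi> :: "'h \<Rightarrow> real ^ 'd"
  assumes lie: "lie_group G" and iso: "lie_group_iso_Rn G \<Phi>"
begin

sublocale group G using lie by (simp add: lie_group_def)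

lemma points_G: "points (grp_man G) = carrier G" and manifold_G: "smooth_manifold (grp_man G)"
  using lie by (simp_all add: lie_group_def)

abbreviation \<Psi> :: "real ^ 'd \<Rightarrow> 'h" where "\<Psi> \<equiv> inv_into (carrier G) \<Phi>"

lemma \<Psi>_carrier [simp]: "\<Psi> x \<in> carrier G" and \<Phi>_\<Psi> [simp]: "\<Phi> (\<Psi> x) = x"
  using iso by (auto simp: lie_group_iso_Rn_def bij_betw_def intro: inv_into_into f_inv_into_f)

lemma \<Psi>_\<Phi> [simp]: "x \<in> carrier G \<Longrightarrow> \<Psi> (\<Phi> x) = x"
  using iso by (auto simp: lie_group_iso_Rn_def bij_betw_def)

lemma \<Phi>_mult: "x \<in> carrier G \<Longrightarrow> y \<in> carrier G \<Longrightarrow> \<Phi> (x \<otimes>\<^bsub>G\<^esub> y) = \<Phi> x + \<Phi> y"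
  using iso by (simp add: lie_group_iso_Rn_def)

lemma \<Phi>_inject: "x \<in> carrier G \<Longrightarrow> y \<in> carrier G \<Longrightarrow> \<Phi> x = \<Phi> y \<longleftrightarrow> x = y"
  by (metis \<Psi>_\<Phi>)

lemma \<Phi>_one: "\<Phi> \<one>\<^bsub>G\<^esub> = 0"
  using \<Phi>_mult[of "\<one>\<^bsub>G\<^esub>" "\<one>\<^bsub>G\<^esub>"] by simp

lemma \<Psi>_zero: "\<Psi> 0 = \<one>\<^bsub>G\<^esub>"
  using \<Psi>_\<Phi>[of "\<one>\<^bsub>G\<^esub>"] \<Phi>_one by simp

lemma \<Phi>_inv: "x \<in> carrier G \<Longrightarrow> \<Phi> (inv\<^bsub>G\<^esub> x) = - \<Phi> x"
  using \<Phi>_mult[of "inv\<^bsub>G\<^esub> x" x] by (simp add: \<Phi>_one eq_neg_iff_add_eq_0)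

lemma smooth_\<Phi>: "smooth_map (grp_man G) euclidean_manifold (carrier G) \<Phi>"
  and smooth_\<Psi>: "smooth_map euclidean_manifold (grp_man G) UNIV \<Psi>"
  using iso by (simp_all add: lie_group_iso_Rn_def)

lemma smooth_\<Phi>_component: "x \<in> carrier G \<Longrightarrow> smooth_near (grp_man G) x (\<lambda>h. \<Phi> h $ b)"
  using smooth_map_smooth_near[OF smooth_\<Phi> _ smooth_euclidean_component] by blast

lemma \<Phi>_curve_differentiable:
  assumes "differentiable_curve (grp_man G) I g" and "s \<in> I"
  shows "(\<lambda>r. \<Phi> (g r)) differentiable (at s within I)"
proof (rule differentiable_within_vecI)
  fix b
  have "g s \<in> carrier G" using differentiable_curve_in_points[OF assms] by (simp add: points_G)
  from differentiable_curve_smooth_near[OF assms smooth_\<Phi>_component[OF this]]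
  show "(\<lambda>r. \<Phi> (g r) $ b) differentiable (at s within I)" .
qed

lemma \<Psi>_curve:
  "(\<And>s. s \<in> I \<Longrightarrow> C differentiable (at s within I)) \<Longrightarrow> differentiable_curve (grp_man G) I (\<lambda>r. \<Psi> (C r))"
  by (rule smooth_map_curve[OF smooth_\<Psi> differentiable_euclidean_curve]) auto

text \<open>The element of the Lie algebra with coordinates \<open>\<xi>\<close>.\<close>

definition lie_vector :: "real ^ 'd \<Rightarrow> 'h tangent" where
  "lie_vector \<xi> = (\<lambda>f. if smooth_near (grp_man G) \<one>\<^bsub>G\<^esub> f then frechet_derivative (\<lambda>x. f (\<Psi> x)) (at 0) \<xi> else 0)"

lemma smooth_near_one_\<Psi>:
  assumes "smooth_near (grp_man G) \<one>\<^bsub>G\<^esub> f"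
  shows "smooth_near euclidean_manifold 0 (\<lambda>x. f (\<Psi> x))"
  using smooth_map_smooth_near[OF smooth_\<Psi>, of 0 f] assms by (simp add: \<Psi>_zero)

lemma smooth_near_one_has_derivative:
  assumes "smooth_near (grp_man G) \<one>\<^bsub>G\<^esub> f"
  shows "((\<lambda>x. f (\<Psi> x)) has_derivative frechet_derivative (\<lambda>x. f (\<Psi> x)) (at 0)) (at 0)"
  using smooth_near_euclidean_differentiable[OF smooth_near_one_\<Psi>[OF assms]]
  by (simp add: frechet_derivative_works)

lemma lie_vector_add: "(\<lambda>f. lie_vector \<xi> f + lie_vector \<eta> f) = lie_vector (\<xi> + \<eta>)"
  by (rule ext) (simp add: lie_vector_def
      linear_add[OF has_derivative_linear[OF smooth_near_one_has_derivative]])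

lemma lie_vector_zero: "lie_vector 0 = (\<lambda>_. 0)"
  by (rule ext) (simp add: lie_vector_def
      linear_0[OF has_derivative_linear[OF smooth_near_one_has_derivative]])

lemma lie_algebra_coords_lie_vector: "lie_algebra_coords \<Phi> (lie_vector \<xi>) = \<xi>"
proof -
  have "frechet_derivative (\<lambda>x :: real ^ 'd. x $ b) (at 0) = (\<lambda>x. x $ b)" for b
    using frechet_derivative_at[OF bounded_linear_imp_has_derivative[OF bounded_linear_vec_nth[of b]]]
    by metis
  then have "lie_vector \<xi> (\<lambda>h. \<Phi> h $ b) = \<xi> $ b" for b
    using smooth_\<Phi>_component[OF one_closed] by (simp add: lie_vector_def)
  then show ?thesis by (simp add: lie_algebra_coords_def vec_eq_iff)
qed

text \<open>The coordinates recover \<xi> from \<open>lie_vector \<xi>\<close>, so the vanishing of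
  an element of the Lie algebra becomes an equation in \<real>^d. This is how horizontality reaches
  ordinary calculus.\<close>

lemma lie_vector_eq_zero_iff: "lie_vector \<xi> = (\<lambda>_. 0) \<longleftrightarrow> \<xi> = 0"
proof
  assume "lie_vector \<xi> = (\<lambda>_. 0)"
  then have "lie_vector \<xi> = lie_vector 0" by (simp only: lie_vector_zero)
  then show "\<xi> = 0" using lie_algebra_coords_lie_vector by metis
qed (simp add: lie_vector_zero)

text \<open>Under \<Phi>, translating \<open>K (c s)\<close> to the identity means subtracting its
  image. A test function thereby becomes \<open>f \<circ> \<Psi>\<close> along a curve in \<real>^d
  that passes through 0 with derivative \<open>v\<close>, and the chain rule at 0 gives
  \<open>lie_vector v\<close>.\<close>

lemma grp_differential_velocity:
  assumes M: "smooth_manifold M" and c: "differentiable_curve M I c" and s: "s \<in> I"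
    and lim: "at s within I \<noteq> bot"
    and K: "smooth_map M (grp_man G) W K" and sW: "c s \<in> W"
    and v: "((\<lambda>r. \<Phi> (K (c r))) has_vector_derivative v) (at s within I)"
  shows "grp_differential G K (c s) (velocity M I c s) = lie_vector v"
proof
  fix f
  show "grp_differential G K (c s) (velocity M I c s) f = lie_vector v f"
  proof (cases "smooth_near (grp_man G) \<one>\<^bsub>G\<^esub> f")
    case False
    then show ?thesis by (simp add: grp_differential_def pushforward_def lie_vector_def)
  next
    case True
    let ?k = "K (c s)"
    let ?f = "\<lambda>q. f (inv\<^bsub>G\<^esub> ?k \<otimes>\<^bsub>G\<^esub> K q)"
    let ?h = "\<lambda>x. f (\<Psi> x)"
    let ?C = "\<lambda>r. \<Phi> (K (c r)) + - \<Phi> ?k"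
    have oW: "openin (man_top M) W" using K by (simp add: smooth_map_def)
    have KG: "K q \<in> carrier G" if "q \<in> W" for q
      using smooth_map_in_points[OF K that] by (simp add: points_G)
    have eq: "f (\<Psi> (\<Phi> (K q) + - \<Phi> ?k)) = ?f q" if "q \<in> W" for q
    proof -
      have "\<Phi> (K q) + - \<Phi> ?k = \<Phi> (inv\<^bsub>G\<^esub> ?k \<otimes>\<^bsub>G\<^esub> K q)"
        using KG[OF that] KG[OF sW] by (simp add: \<Phi>_mult \<Phi>_inv)
      then show ?thesis using KG[OF that] KG[OF sW] by simp
    qed
    \<comment> \<open>Smoothness of the translated test function is obtained by translating in
      \<real>^d and pulling back along \<Phi> and \<open>K\<close>; \<open>eq\<close> then
      identifies the result on \<open>W\<close> with the function defined by group
      multiplication.\<close>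
    have "smooth_near euclidean_manifold (\<Phi> ?k) (\<lambda>x. ?h (x + - \<Phi> ?k))"
      by (rule smooth_near_euclidean_translate) (simp add: smooth_near_one_\<Psi>[OF True])
    from smooth_map_smooth_near[OF smooth_\<Phi> KG[OF sW] this]
    have "smooth_near (grp_man G) ?k (\<lambda>x. ?h (\<Phi> x + - \<Phi> ?k))" .
    from smooth_map_smooth_near[OF K sW this]
    have "smooth_near M (c s) (\<lambda>q. ?h (\<Phi> (K q) + - \<Phi> ?k))" .
    from smooth_near_cong[OF M oW sW eq this]
    have near: "smooth_near M (c s) ?f" .
    have "(?C has_vector_derivative v) (at s within I)"
      using has_vector_derivative_add[OF v has_vector_derivative_const[of "- \<Phi> ?k"]] by simp
    \<comment> \<open>Here \<open>?C s = 0\<close>, the point at which the derivative of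
      \<open>?h\<close> is known.\<close>
    moreover have "(?h has_derivative frechet_derivative ?h (at 0)) (at (?C s) within ?C ` I)"
      using has_derivative_at_withinI[OF smooth_near_one_has_derivative[OF True]] by simp
    ultimately have "((\<lambda>r. ?h (?C r)) has_vector_derivative frechet_derivative ?h (at 0) v) (at s within I)"
      using vector_derivative_diff_chain_within[of ?C v s I ?h] by (simp add: o_def)
    then have "vector_derivative (\<lambda>r. ?h (?C r)) (at s within I) = frechet_derivative ?h (at 0) v"
      using lim by (simp add: vector_derivative_within)
    moreover have "vector_derivative (\<lambda>r. ?h (?C r)) (at s within I) = vector_derivative (\<lambda>r. ?f (c r)) (at s within I)"
      using differentiable_curve_eventually[OF c s oW sW] s eq
      by (intro vector_derivative_cong_eq) (auto elim!: eventually_mono)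
    ultimately show ?thesis
      using True near by (simp add: grp_differential_def pushforward_def lie_vector_def velocity_def)
  qed
qed

end

section \<open>The group coordinate of a trivialization\<close>

lemma local_trivialization_smooth_coord:
  assumes P: "principal_bundle G P" and triv: "local_trivialization G P U \<psi>"
  shows "smooth_map (total_space P) (grp_man G) (part_over P U) (\<lambda>e. snd (\<psi> e))"
  unfolding smooth_map_def
proof (intro conjI ballI allI impI)
  let ?P = "product_manifold (base_space P) (grp_man G)"
  have \<psi>: "smooth_map (total_space P) ?P (part_over P U) \<psi>"
    using triv by (simp add: local_trivialization_def)
  then show "openin (man_top (total_space P)) (part_over P U)" by (simp add: smooth_map_def)
  have "continuous_map (subtopology (man_top (total_space P)) (part_over P U)) (man_top ?P) \<psi>"
    using \<psi> by (simp add: smooth_map_def)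
  then show "continuous_map (subtopology (man_top (total_space P)) (part_over P U)) (man_top (grp_man G)) (\<lambda>e. snd (\<psi> e))"
    using continuous_map_compose[OF _ continuous_map_snd, of _ "man_top (base_space P)" "man_top (grp_man G)" \<psi>]
    by (simp add: product_manifold_def o_def)
  fix e f assume e: "e \<in> part_over P U" and f: "smooth_near (grp_man G) (snd (\<psi> e)) f"
  have "\<psi> e \<in> points ?P" by (rule smooth_map_in_points[OF \<psi> e])
  then have "fst (\<psi> e) \<in> points (base_space P)" by (auto simp: product_manifold_def)
  moreover have "smooth_manifold (base_space P)" "smooth_manifold (grp_man G)"
    using P by (simp_all add: principal_bundle_def lie_group_def)
  ultimately have "smooth_near ?P (\<psi> e) (\<lambda>x. f (snd x))"
    using smooth_near_snd[OF _ _ _ f, of "base_space P" "fst (\<psi> e)"] by simp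
  from smooth_map_smooth_near[OF \<psi> e this]
  show "smooth_near (total_space P) e (\<lambda>e. f (snd (\<psi> e)))" .
qed

section \<open>Limits in a disjoint union of manifolds\<close>

lemma limitin_disjoint_unionI:
  assumes "i \<in> {1..n}" and "limitin (man_top (X i)) (\<lambda>r. snd (\<gamma> r)) p F"
    and "eventually (\<lambda>r. fst (\<gamma> r) = i) F"
  shows "limitin (disjoint_union n X) \<gamma> (i, p) F"
  unfolding limitin_def
proof (intro conjI allI impI)
  show "(i, p) \<in> topspace (disjoint_union n X)"
    using assms(1,2) by (auto simp: disjoint_union_def limitin_def)
  fix V assume "openin (disjoint_union n X) V \<and> (i, p) \<in> V"
  then have "openin (man_top (X i)) {x. (i, x) \<in> V}" "p \<in> {x. (i, x) \<in> V}"
    using assms(1) by (auto simp: disjoint_union_def openin_sum_topology)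
  then have "eventually (\<lambda>r. snd (\<gamma> r) \<in> {x. (i, x) \<in> V}) F"
    using assms(2) by (auto simp: limitin_def)
  with assms(3) show "eventually (\<lambda>r. \<gamma> r \<in> V) F" by eventually_elim (auto simp: prod_eq_iff)
qed

text \<open>Each \<open>{i} \<times> V\<close> with \<open>V\<close> open in component
  \<open>i\<close> is open in the sum, so a limit determines both the component in which the curve
  eventually stays and the limit inside it.\<close>

lemma limitin_disjoint_unionD:
  assumes "limitin (disjoint_union n X) \<gamma> (i, p) F"
  shows "i \<in> {1..n}" and "limitin (man_top (X i)) (\<lambda>r. snd (\<gamma> r)) p F"
    and "eventually (\<lambda>r. fst (\<gamma> r) = i) F"
proof -
  have ip: "i \<in> {1..n}" "p \<in> points (X i)"
    using limitin_topspace[OF assms] by (auto simp: disjoint_union_def)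
  then show "i \<in> {1..n}" by simp
  have *: "eventually (\<lambda>r. \<gamma> r \<in> {i} \<times> V) F" if "openin (man_top (X i)) V" "p \<in> V" for V
  proof -
    have "openin (man_top (X j)) {x. (j, x) \<in> {i} \<times> V}" for j
      using that(1) by (cases "j = i") auto
    then have "openin (disjoint_union n X) ({i} \<times> V)"
      using ip(1) openin_subset[OF that(1)] by (auto simp: disjoint_union_def openin_sum_topology)
    then show ?thesis using assms that(2) by (auto simp: limitin_def)
  qed
  show "limitin (man_top (X i)) (\<lambda>r. snd (\<gamma> r)) p F"
    unfolding limitin_def
  proof (intro conjI allI impI ip(2))
    fix V assume "openin (man_top (X i)) V \<and> p \<in> V"
    with *[of V] show "eventually (\<lambda>r. snd (\<gamma> r) \<in> V) F" by (auto elim!: eventually_mono)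
  qed
  show "eventually (\<lambda>r. fst (\<gamma> r) = i) F"
    using *[OF openin_topspace ip(2)] by (rule eventually_mono) auto
qed

text \<open>With Hausdorff components, limits in the sum along a nontrivial filter are unique, so
  the descriptions by \<open>THE\<close> in \<open>value_before\<close> and
  \<open>value_after\<close> denote the limits whenever these exist.\<close>

definition hausdorff_family :: "nat \<Rightarrow> (nat \<Rightarrow> ('a, 'v) manifold) \<Rightarrow> bool" where
  "hausdorff_family n X \<longleftrightarrow> (\<forall>i\<in>{1..n}. Hausdorff_space (man_top (X i)))"

lemma limitin_disjoint_union_unique:
  assumes X: "hausdorff_family n X" and F: "F \<noteq> bot"
    and p: "limitin (disjoint_union n X) \<gamma> p F" and q: "limitin (disjoint_union n X) \<gamma> q F"
  shows "p = q"
proof -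
  obtain i x j y where ij: "p = (i, x)" "q = (j, y)" by (cases p, cases q)
  note P = limitin_disjoint_unionD[OF p[unfolded ij]] and Q = limitin_disjoint_unionD[OF q[unfolded ij]]
  have "eventually (\<lambda>r. i = j) F" using P(3) Q(3) by eventually_elim simp
  then have [simp]: "i = j" using F by simp
  have "x = y"
    using limitin_Hausdorff_unique[OF P(2)] Q(2) P(1) F X by (simp add: hausdorff_family_def)
  then show ?thesis by (simp add: ij)
qed

lemma value_after_eq:
  assumes "hausdorff_family n X" and "limitin (disjoint_union n X) \<gamma> p (at_right s)"
  shows "value_after (disjoint_union n X) \<gamma> s = p"
  unfolding value_after_def
  by (rule the_equality[where P = "\<lambda>p. limitin _ _ p _", OF assms(2)])
    (rule limitin_disjoint_union_unique[OF assms(1) _ _ assms(2)], simp_all)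

lemma value_before_eq:
  assumes "hausdorff_family n X" and "limitin (disjoint_union n X) \<gamma> p (at_left s)"
  shows "value_before (disjoint_union n X) \<gamma> s = p"
  unfolding value_before_def
  by (rule the_equality[where P = "\<lambda>p. limitin _ _ p _", OF assms(2)])
    (rule limitin_disjoint_union_unique[OF assms(1) _ _ assms(2)], simp_all)

lemma curve_limit_right:
  assumes "differentiable_curve M {a..b} c" and "a \<le> s" and "s < b"
  shows "limitin (man_top M) c (c s) (at_right s)"
  unfolding limitin_def
proof (intro conjI allI impI)
  show "c s \<in> points M" using assms by (intro differentiable_curve_in_points[OF assms(1)]) auto
  fix V assume "openin (man_top M) V \<and> c s \<in> V"
  then have "eventually (\<lambda>r. r \<in> {a..b} \<longrightarrow> c r \<in> V) (nhds s)"
    using assms by (intro differentiable_curve_eventually[OF assms(1)]) auto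
  then have "eventually (\<lambda>r. r \<in> {a..b} \<longrightarrow> c r \<in> V) (at_right s)"
    by (simp add: eventually_at_filter eventually_mono)
  with eventually_at_right_real[OF assms(3)] show "eventually (\<lambda>r. c r \<in> V) (at_right s)"
    by eventually_elim (use assms in auto)
qed

lemma curve_limit_left:
  assumes "differentiable_curve M {a..b} c" and "a < s" and "s \<le> b"
  shows "limitin (man_top M) c (c s) (at_left s)"
  unfolding limitin_def
proof (intro conjI allI impI)
  show "c s \<in> points M" using assms by (intro differentiable_curve_in_points[OF assms(1)]) auto
  fix V assume "openin (man_top M) V \<and> c s \<in> V"
  then have "eventually (\<lambda>r. r \<in> {a..b} \<longrightarrow> c r \<in> V) (nhds s)"
    using assms by (intro differentiable_curve_eventually[OF assms(1)]) auto
  then have "eventually (\<lambda>r. r \<in> {a..b} \<longrightarrow> c r \<in> V) (at_left s)"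
    by (simp add: eventually_at_filter eventually_mono)
  with eventually_at_left_real[OF assms(2)] show "eventually (\<lambda>r. c r \<in> V) (at_left s)"
    by eventually_elim (use assms in auto)
qed

lemma limitin_cong_eventually:
  assumes "limitin T f l F" and "eventually (\<lambda>r. f r = g r) F"
  shows "limitin T g l F"
  using assms by (rule limitin_transform_eventually[rotated])

section \<open>Hybrid curves\<close>

lemma partition_le:
  fixes t :: "nat \<Rightarrow> real"
  assumes "\<And>k. k \<le> N \<Longrightarrow> t k < t (Suc k)" and "j \<le> k" and "k \<le> Suc N"
  shows "t j \<le> t k"
  using assms(2,3)
proof (induction k rule: dec_induct)
  case (step k)
  then show ?case using assms(1)[of k] by simp
qed simp

lemma partition_cover:
  fixes t :: "nat \<Rightarrow> real"
  assumes "t 0 < s" and "s \<le> t (Suc N)"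
  obtains k where "k \<le> N" and "s \<in> {t k<..t (Suc k)}"
proof -
  define k where "k = (LEAST k. s \<le> t (Suc k))"
  have le: "s \<le> t (Suc k)" unfolding k_def by (rule LeastI) (rule assms(2))
  have N: "k \<le> N" unfolding k_def by (rule Least_le) (rule assms(2))
  have "t k < s"
  proof (cases k)
    case (Suc j)
    then have "\<not> s \<le> t (Suc j)" using not_less_Least[of j "\<lambda>k. s \<le> t (Suc k)"] by (simp add: k_def)
    then show ?thesis using Suc by simp
  qed (use assms in simp)
  with le N that show ?thesis by simp
qed

lemma Least_partition:
  fixes t :: "nat \<Rightarrow> real"
  assumes "\<And>k. k \<le> N \<Longrightarrow> t k < t (Suc k)" and "k \<le> N" and "s \<in> {t k<..t (Suc k)}"
  shows "(LEAST k. s \<le> t (Suc k)) = k"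
proof (rule Least_equality)
  fix j assume "s \<le> t (Suc j)"
  show "k \<le> j"
  proof (rule ccontr)
    assume "\<not> k \<le> j"
    then have "t (Suc j) \<le> t k" using assms(2) by (intro partition_le[of N t, OF assms(1)]) auto
    then show False using \<open>s \<le> t (Suc j)\<close> assms(3) by simp
  qed
qed (use assms in simp)

section \<open>Decomposing hybrid curves into pieces and gluing pieces\<close>

lemma hybrid_curve_partition:
  assumes "hybrid_curve n X N t \<gamma>"
  shows "t 0 = 0" and "t (Suc N) = 1" and "\<And>k. k \<le> N \<Longrightarrow> t k < t (Suc k)"
    and "\<And>k. k \<le> Suc N \<Longrightarrow> t k \<in> {0..1}"
proof -
  show t: "t 0 = 0" "t (Suc N) = 1" "\<And>k. k \<le> N \<Longrightarrow> t k < t (Suc k)"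
    using assms by (simp_all add: hybrid_curve_def)
  show "t k \<in> {0..1}" if "k \<le> Suc N" for k
    using partition_le[of N t, OF t(3), of 0 k] partition_le[of N t, OF t(3), of k "Suc N"] that t(1,2) by simp
qed

text \<open>Two facts go beyond unfolding. The right-hand limit at \<open>t k\<close> has the index
  of the piece, because the index is eventually constant both for the limit and on the interval. The
  left-hand limit at \<open>t (Suc k)\<close> is the value there, by continuity of the
  piece.\<close>

lemma hybrid_curve_piece:
  assumes X: "hausdorff_family n X" and c: "hybrid_curve n X N t \<gamma>" and k: "k \<le> N"
  shows "comp_index \<gamma> t k \<in> {1..n}"
    and "differentiable_curve (X (comp_index \<gamma> t k)) {t k..t (Suc k)} (piece (disjoint_union n X) \<gamma> (t k))"
    and "\<And>s. s \<in> {t k<..t (Suc k)} \<Longrightarrow> \<gamma> s = (comp_index \<gamma> t k, piece (disjoint_union n X) \<gamma> (t k) s)"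
    and "value_after (disjoint_union n X) \<gamma> (t k) = (comp_index \<gamma> t k, piece (disjoint_union n X) \<gamma> (t k) (t k))"
    and "value_before (disjoint_union n X) \<gamma> (t (Suc k)) = \<gamma> (t (Suc k))"
proof -
  let ?T = "disjoint_union n X" and ?i = "comp_index \<gamma> t k"
  let ?c = "piece ?T \<gamma> (t k)"
  have tk: "t k < t (Suc k)" by (rule hybrid_curve_partition(3)[OF c k])
  show i: "?i \<in> {1..n}" and d: "differentiable_curve (X ?i) {t k..t (Suc k)} ?c"
    using c k by (simp_all add: hybrid_curve_def)
  have fst: "fst (\<gamma> s) = ?i" if "s \<in> {t k<..t (Suc k)}" for s
    using c k that by (simp add: hybrid_curve_def)
  show g: "\<gamma> s = (?i, ?c s)" if "s \<in> {t k<..t (Suc k)}" for s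
    using fst[OF that] that by (auto simp: piece_def prod_eq_iff)
  from c k obtain p where p: "limitin ?T \<gamma> p (at_right (t k))" by (auto simp: hybrid_curve_def)
  have "eventually (\<lambda>r. fst (\<gamma> r) = fst p) (at_right (t k))"
    using limitin_disjoint_unionD(3)[of n X \<gamma> "fst p" "snd p"] p by simp
  moreover have "eventually (\<lambda>r. fst (\<gamma> r) = ?i) (at_right (t k))"
    using eventually_at_right_real[OF tk] by (rule eventually_mono) (simp add: fst)
  ultimately have "eventually (\<lambda>r. fst p = ?i) (at_right (t k))" by eventually_elim simp
  then have "fst p = ?i" by simp
  then show "value_after ?T \<gamma> (t k) = (?i, ?c (t k))"
    using value_after_eq[OF X p] by (simp add: piece_def prod_eq_iff)
  have "limitin ?T \<gamma> (?i, ?c (t (Suc k))) (at_left (t (Suc k)))"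
  proof (rule limitin_disjoint_unionI[OF i])
    have ev: "eventually (\<lambda>r. r \<in> {t k<..<t (Suc k)}) (at_left (t (Suc k)))"
      by (rule eventually_at_left_real[OF tk])
    then show "eventually (\<lambda>r. fst (\<gamma> r) = ?i) (at_left (t (Suc k)))"
      by (rule eventually_mono) (simp add: fst)
    have "limitin (man_top (X ?i)) ?c (?c (t (Suc k))) (at_left (t (Suc k)))"
      by (rule curve_limit_left[OF d tk]) simp
    then show "limitin (man_top (X ?i)) (\<lambda>r. snd (\<gamma> r)) (?c (t (Suc k))) (at_left (t (Suc k)))"
      by (rule limitin_cong_eventually) (use ev in \<open>auto elim!: eventually_mono simp: g\<close>)
  qed
  from value_before_eq[OF X this] show "value_before ?T \<gamma> (t (Suc k)) = \<gamma> (t (Suc k))"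
    using g[of "t (Suc k)"] tk by simp
qed

lemma hybrid_curve_value_after_start:
  assumes "hausdorff_family n X" and "hybrid_curve n X N t \<gamma>"
  shows "value_after (disjoint_union n X) \<gamma> (t 0) = \<gamma> 0"
  using assms by (auto simp: hybrid_curve_def intro: value_after_eq)

text \<open>No matching condition links consecutive \<open>L k\<close>: for \<open>k > 0\<close> the
  value at \<open>t k\<close> belongs to the piece before, while \<open>L k (t k)\<close> is only a
  right-hand limit. The value at 0 is prescribed separately, as 0 lies in none of the half-open
  intervals.\<close>

lemma hybrid_curve_glue:
  assumes X: "hausdorff_family n X" and t: "t 0 = 0" "t (Suc N) = 1" "\<And>k. k \<le> N \<Longrightarrow> t k < t (Suc k)"
    and i: "\<And>k. k \<le> N \<Longrightarrow> i k \<in> {1..n}"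
    and L: "\<And>k. k \<le> N \<Longrightarrow> differentiable_curve (X (i k)) {t k..t (Suc k)} (L k)"
    and \<gamma>: "\<And>k s. k \<le> N \<Longrightarrow> s \<in> {t k<..t (Suc k)} \<Longrightarrow> \<gamma> s = (i k, L k s)"
    and \<gamma>0: "\<gamma> 0 = (i 0, L 0 0)"
  shows "hybrid_curve n X N t \<gamma>"
    and "\<And>k. k \<le> N \<Longrightarrow> comp_index \<gamma> t k = i k"
    and "\<And>k s. k \<le> N \<Longrightarrow> s \<in> {t k..t (Suc k)} \<Longrightarrow> piece (disjoint_union n X) \<gamma> (t k) s = L k s"
proof -
  let ?T = "disjoint_union n X"
  show ci: "comp_index \<gamma> t k = i k" if "k \<le> N" for k
    using \<gamma>[OF that, of "t (Suc k)"] t(3)[OF that] by (simp add: comp_index_def)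
  have lim: "limitin ?T \<gamma> (i k, L k (t k)) (at_right (t k))" if k: "k \<le> N" for k
  proof (rule limitin_disjoint_unionI[OF i[OF k]])
    have ev: "eventually (\<lambda>r. r \<in> {t k<..<t (Suc k)}) (at_right (t k))"
      by (rule eventually_at_right_real[OF t(3)[OF k]])
    then show "eventually (\<lambda>r. fst (\<gamma> r) = i k) (at_right (t k))"
      by (rule eventually_mono) (simp add: \<gamma>[OF k])
    have "limitin (man_top (X (i k))) (L k) (L k (t k)) (at_right (t k))"
      by (rule curve_limit_right[OF L[OF k] _ t(3)[OF k]]) simp
    then show "limitin (man_top (X (i k))) (\<lambda>r. snd (\<gamma> r)) (L k (t k)) (at_right (t k))"
      by (rule limitin_cong_eventually) (use ev in \<open>auto elim!: eventually_mono simp: \<gamma>[OF k]\<close>)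
  qed
  show pc: "piece ?T \<gamma> (t k) s = L k s" if k: "k \<le> N" and s: "s \<in> {t k..t (Suc k)}" for k s
    using value_after_eq[OF X lim[OF k]] \<gamma>[OF k, of s] s by (auto simp: piece_def)
  show "hybrid_curve n X N t \<gamma>"
    unfolding hybrid_curve_def
  proof (intro conjI allI impI t)
    show "limitin ?T \<gamma> (\<gamma> 0) (at_right 0)" using lim[of 0] t(1) \<gamma>0 by simp
    fix k assume k: "k \<le> N"
    show "comp_index \<gamma> t k \<in> {1..n}" using i[OF k] by (simp add: ci[OF k])
    show "\<forall>s\<in>{t k<..t (Suc k)}. fst (\<gamma> s) = comp_index \<gamma> t k" by (simp add: \<gamma>[OF k] ci[OF k])
    show "\<exists>p. limitin ?T \<gamma> p (at_right (t k))" using lim[OF k] by blast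
    show "differentiable_curve (X (comp_index \<gamma> t k)) {t k..t (Suc k)} (piece ?T \<gamma> (t k))"
      unfolding ci[OF k] using L[OF k] by (rule differentiable_curve_cong) (simp add: pc[OF k])
  qed
qed

section \<open>Horizontal lifts over the trivialized part\<close>

locale trivialized_hybrid_bundle = lie_group_Rn G \<Phi>
  for G :: "('h, 'w::euclidean_space) lie_grp" and \<Phi> :: "'h \<Rightarrow> real ^ 'd" +
  fixes H :: "('e, 'u::euclidean_space, 'm, 'v::euclidean_space, 'h) hybrid_bundle"
    and \<omega> :: "nat \<Rightarrow> ('e, 'h) lie_valued_form"
    and U :: "nat \<Rightarrow> 'm set"
    and \<sigma> :: "nat \<Rightarrow> 'm \<Rightarrow> 'e"
    and A :: "nat \<Rightarrow> ('m, 'h) lie_valued_form"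
    and F :: "nat \<Rightarrow> 'm \<Rightarrow> 'h"
  assumes hybrid_bundle: "hybrid_principal_bundle G H"
    and triv: "\<And>i. i \<in> {1..num H} \<Longrightarrow>
      local_trivialization G (comp_bundle H i) (U i) (section_trivialization G (comp_bundle H i) (\<sigma> i))"
    and connection_coords: "\<And>i e X. \<lbrakk>i \<in> {1..num H}; e \<in> part_over (comp_bundle H i) (U i);
        X \<in> tangent_space (tot H i) e\<rbrakk> \<Longrightarrow>
      \<omega> i e X = (\<lambda>f. grp_differential G (grp_coord G (comp_bundle H i) (\<sigma> i)) e X f
        + A i (bundle_proj (comp_bundle H i) e)
            (pushforward (base H i) (bundle_proj (comp_bundle H i) e) (bundle_proj (comp_bundle H i)) X) f)"
    and resets_trivial: "\<And>i j e. \<lbrakk>i \<in> {1..num H}; j \<in> {1..num H};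
        e \<in> part_over (comp_bundle H i) (guard H i j \<inter> U i);
        reset H i j (bundle_proj (comp_bundle H i) e) \<in> U j\<rbrakk> \<Longrightarrow>
      grp_coord G (comp_bundle H j) (\<sigma> j) (lifted_reset H i j e) =
      grp_coord G (comp_bundle H i) (\<sigma> i) e"
    and smooth_F: "\<And>i. i \<in> {1..num H} \<Longrightarrow> smooth_map (base H i) (grp_man G) (points (base H i)) (F i)"
    and exact: "\<And>i m X. \<lbrakk>i \<in> {1..num H}; m \<in> U i; X \<in> tangent_space (base H i) m\<rbrakk> \<Longrightarrow>
      A i m X = grp_differential G (F i) m X"
begin

section \<open>Points, group action and curves in the trivializations\<close>

abbreviation proj :: "nat \<Rightarrow> 'e \<Rightarrow> 'm" where "proj i \<equiv> bundle_proj (comp_bundle H i)"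
abbreviation triv_part :: "nat \<Rightarrow> 'e set" where "triv_part i \<equiv> part_over (comp_bundle H i) (U i)"
abbreviation coord :: "nat \<Rightarrow> 'e \<Rightarrow> 'h" where "coord i \<equiv> grp_coord G (comp_bundle H i) (\<sigma> i)"

text \<open>Taken as a value of the inverse trivialization, because the smoothness of that inverse
  is part of \<open>local_trivialization\<close> and makes lifted curves differentiable.\<close>

definition lift_point :: "nat \<Rightarrow> 'm \<Rightarrow> 'h \<Rightarrow> 'e" where
  "lift_point i m h = inv_into (triv_part i) (section_trivialization G (comp_bundle H i) (\<sigma> i)) (m, h)"

lemma principal: "i \<in> {1..num H} \<Longrightarrow> principal_bundle G (comp_bundle H i)"
  using hybrid_bundle by (simp add: hybrid_principal_bundle_def)

lemma manifold_tot: "i \<in> {1..num H} \<Longrightarrow> smooth_manifold (tot H i)"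
  and manifold_base: "i \<in> {1..num H} \<Longrightarrow> smooth_manifold (base H i)"
  and smooth_proj: "i \<in> {1..num H} \<Longrightarrow> smooth_map (tot H i) (base H i) (points (tot H i)) (proj i)"
  using principal by (auto simp: principal_bundle_def)

lemma hausdorff_tot: "hausdorff_family (num H) (tot H)"
  and hausdorff_base: "hausdorff_family (num H) (base H)"
  using manifold_tot manifold_base by (auto simp: hausdorff_family_def smooth_manifold_def)

lemma U_points: "i \<in> {1..num H} \<Longrightarrow> U i \<subseteq> points (base H i)"
  using triv[of i] openin_subset[of "man_top (base H i)" "U i"] by (auto simp: local_trivialization_def)

lemma triv_bij:
  "i \<in> {1..num H} \<Longrightarrow>
    bij_betw (section_trivialization G (comp_bundle H i) (\<sigma> i)) (triv_part i) (U i \<times> carrier G)"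
  using triv by (simp add: local_trivialization_def)

lemma coord_carrier: "i \<in> {1..num H} \<Longrightarrow> e \<in> triv_part i \<Longrightarrow> coord i e \<in> carrier G"
  using bij_betwE[OF triv_bij] by (auto simp: section_trivialization_def)

lemma triv_part_eqI:
  assumes "i \<in> {1..num H}" and "e \<in> triv_part i" and "e' \<in> triv_part i"
    and "proj i e = proj i e'" and "coord i e = coord i e'"
  shows "e = e'"
  using bij_betw_imp_inj_on[OF triv_bij[OF assms(1)]] assms(2-5)
  by (auto simp: inj_on_def section_trivialization_def)

lemma lift_point:
  assumes i: "i \<in> {1..num H}" and "m \<in> U i" and "h \<in> carrier G"
  shows "lift_point i m h \<in> triv_part i" and "proj i (lift_point i m h) = m"
    and "coord i (lift_point i m h) = h"
proof -
  let ?\<psi> = "section_trivialization G (comp_bundle H i) (\<sigma> i)"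
  have mh: "(m, h) \<in> ?\<psi> ` triv_part i"
    using bij_betw_imp_surj_on[OF triv_bij[OF i]] assms(2,3) by simp
  show "lift_point i m h \<in> triv_part i" unfolding lift_point_def by (rule inv_into_into[OF mh])
  have "?\<psi> (lift_point i m h) = (m, h)" unfolding lift_point_def by (rule f_inv_into_f[OF mh])
  then show "proj i (lift_point i m h) = m" "coord i (lift_point i m h) = h"
    by (simp_all add: section_trivialization_def)
qed

lemma action_triv_part:
  assumes i: "i \<in> {1..num H}" and e: "e \<in> triv_part i" and h: "h \<in> carrier G"
  shows "action (comp_bundle H i) e h \<in> triv_part i" and "proj i (action (comp_bundle H i) e h) = proj i e"
    and "coord i (action (comp_bundle H i) e h) = coord i e \<otimes>\<^bsub>G\<^esub> h"
proof -
  let ?P = "comp_bundle H i"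
  have ep: "e \<in> points (tot H i)" using e by (simp add: part_over_def)
  have "section_trivialization G ?P (\<sigma> i) (action ?P e h) =
      (proj i e, snd (section_trivialization G ?P (\<sigma> i) e) \<otimes>\<^bsub>G\<^esub> h)"
    using triv[OF i] e h by (simp add: local_trivialization_def)
  then show pr: "proj i (action ?P e h) = proj i e" and "coord i (action ?P e h) = coord i e \<otimes>\<^bsub>G\<^esub> h"
    by (simp_all add: section_trivialization_def)
  have act: "smooth_map (product_manifold (tot H i) (grp_man G)) (tot H i)
      (points (tot H i) \<times> carrier G) (\<lambda>(e, h). action ?P e h)"
    using principal[OF i] by (simp add: principal_bundle_def)
  have "action ?P e h \<in> points (tot H i)"
    using smooth_map_in_points[OF act, of "(e, h)"] ep h by simp
  then show "action ?P e h \<in> triv_part i" using pr e by (simp add: part_over_def)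
qed

lemma smooth_coord:
  assumes "i \<in> {1..num H}"
  shows "smooth_map (tot H i) (grp_man G) (triv_part i) (coord i)"
  using local_trivialization_smooth_coord[OF principal[OF assms] triv[OF assms]]
  by (simp add: section_trivialization_def)

lemma lift_point_curve:
  assumes i: "i \<in> {1..num H}" and m: "differentiable_curve (base H i) I m" and mU: "\<And>r. r \<in> I \<Longrightarrow> m r \<in> U i"
    and C: "\<And>s. s \<in> I \<Longrightarrow> C differentiable (at s within I)"
  shows "differentiable_curve (tot H i) I (\<lambda>r. lift_point i (m r) (\<Psi> (C r)))"
proof -
  have "smooth_map (product_manifold (base H i) (grp_man G)) (tot H i) (U i \<times> carrier G)
      (inv_into (triv_part i) (section_trivialization G (comp_bundle H i) (\<sigma> i)))"
    using triv[OF i] by (simp add: local_trivialization_def)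
  from smooth_map_curve[OF this product_curve[OF manifold_base[OF i] manifold_G m \<Psi>_curve[OF C]]]
  show ?thesis using mU by (simp add: lift_point_def)
qed

section \<open>The local forms and the connection along curves\<close>

lemma form_velocity:
  assumes i: "i \<in> {1..num H}" and m: "differentiable_curve (base H i) I m" and mU: "\<And>r. r \<in> I \<Longrightarrow> m r \<in> U i"
    and s: "s \<in> I" and lim: "at s within I \<noteq> bot"
  obtains v where "((\<lambda>r. \<Phi> (F i (m r))) has_vector_derivative v) (at s within I)"
    and "A i (m s) (velocity (base H i) I m s) = lie_vector v"
proof -
  have mp: "m r \<in> points (base H i)" if "r \<in> I" for r using U_points[OF i] mU[OF that] by blast
  have "differentiable_curve (grp_man G) I (\<lambda>r. F i (m r))"
    by (rule smooth_map_curve[OF smooth_F[OF i] m mp])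
  from \<Phi>_curve_differentiable[OF this s] obtain v
    where v: "((\<lambda>r. \<Phi> (F i (m r))) has_vector_derivative v) (at s within I)"
    using vector_derivative_works by blast
  have "A i (m s) (velocity (base H i) I m s) = lie_vector v"
    unfolding exact[OF i mU[OF s] velocity_in_tangent_space[OF m s lim]]
    by (rule grp_differential_velocity[OF manifold_base[OF i] m s lim smooth_F[OF i] mp[OF s] v])
  with v that show ?thesis by blast
qed

text \<open>For the gauge integral, the fundamental theorem of calculus needs only a derivative at
  every point of the interval, one-sided at its ends. This matters because the curve is merely
  differentiable, so the integrand might not be continuous.\<close>

lemma form_integral:
  assumes i: "i \<in> {1..num H}" and "a < b" and m: "differentiable_curve (base H i) {a..b} m"
    and mU: "\<And>r. r \<in> {a..b} \<Longrightarrow> m r \<in> U i"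
  shows "integral {a..b} (\<lambda>s. lie_algebra_coords \<Phi> (A i (m s) (velocity (base H i) {a..b} m s))) =
    \<Phi> (F i (m b)) - \<Phi> (F i (m a))"
proof (rule integral_unique, rule fundamental_theorem_of_calculus)
  show "a \<le> b" using assms(2) by simp
  fix s assume s: "s \<in> {a..b}"
  have "at s within {a..b} \<noteq> bot"
    using s assms(2) by (simp add: trivial_limit_within islimpt_Icc)
  with i m mU s obtain v where "((\<lambda>r. \<Phi> (F i (m r))) has_vector_derivative v) (at s within {a..b})"
    and "A i (m s) (velocity (base H i) {a..b} m s) = lie_vector v"
    by (rule form_velocity)
  then show "((\<lambda>r. \<Phi> (F i (m r))) has_vector_derivative
      lie_algebra_coords \<Phi> (A i (m s) (velocity (base H i) {a..b} m s))) (at s within {a..b})"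
    by (simp add: lie_algebra_coords_lie_vector)
qed

text \<open>The projection carries the velocity of \<open>L\<close> to that of \<open>m\<close>, so
  the two terms of \<omega> are \<open>lie_vector w\<close> and \<open>lie_vector v\<close>, where
  \<open>w\<close> and \<open>v\<close> are the derivatives of \<Phi> of the group coordinate and of
  \<Phi> of \<open>F\<close>. An equivalence is stated because computing the end of a lift uses one
  direction and constructing a lift the other.\<close>

lemma horizontal_iff:
  assumes i: "i \<in> {1..num H}" and L: "differentiable_curve (tot H i) I L"
    and m: "differentiable_curve (base H i) I m" and mU: "\<And>r. r \<in> I \<Longrightarrow> m r \<in> U i"
    and Lm: "\<And>r. r \<in> I \<Longrightarrow> proj i (L r) = m r"
    and s: "s \<in> I" and lim: "at s within I \<noteq> bot"
  shows "\<omega> i (L s) (velocity (tot H i) I L s) = (\<lambda>_. 0) \<longleftrightarrow>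
    ((\<lambda>r. \<Phi> (coord i (L r)) + \<Phi> (F i (m r))) has_vector_derivative 0) (at s within I)"
proof -
  have LU: "L r \<in> triv_part i" if "r \<in> I" for r
    using differentiable_curve_in_points[OF L that] mU[OF that] Lm[OF that] by (simp add: part_over_def)
  have Lp: "L s \<in> points (tot H i)" using LU[OF s] by (simp add: part_over_def)
  obtain v where v: "((\<lambda>r. \<Phi> (F i (m r))) has_vector_derivative v) (at s within I)"
    and A: "A i (m s) (velocity (base H i) I m s) = lie_vector v"
    using i m mU s lim by (rule form_velocity)
  have "differentiable_curve (grp_man G) I (\<lambda>r. coord i (L r))"
    by (rule smooth_map_curve[OF smooth_coord[OF i] L LU])
  from \<Phi>_curve_differentiable[OF this s] obtain w
    where w: "((\<lambda>r. \<Phi> (coord i (L r))) has_vector_derivative w) (at s within I)"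
    using vector_derivative_works by blast
  have g: "grp_differential G (coord i) (L s) (velocity (tot H i) I L s) = lie_vector w"
    by (rule grp_differential_velocity[OF manifold_tot[OF i] L s lim smooth_coord[OF i] LU[OF s] w])
  have "pushforward (base H i) (proj i (L s)) (proj i) (velocity (tot H i) I L s) =
      velocity (base H i) I (\<lambda>r. proj i (L r)) s"
    by (rule velocity_pushforward[OF smooth_proj[OF i], of L s, OF Lp])
  also have "\<dots> = velocity (base H i) I m s" by (rule velocity_cong[OF s Lm])
  finally have "\<omega> i (L s) (velocity (tot H i) I L s) = (\<lambda>f. lie_vector w f + lie_vector v f)"
    using connection_coords[OF i LU[OF s] velocity_in_tangent_space[OF L s lim]] Lm[OF s] A g by simp
  then have iff: "\<omega> i (L s) (velocity (tot H i) I L s) = (\<lambda>_. 0) \<longleftrightarrow> w + v = 0"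
    by (simp add: lie_vector_add lie_vector_eq_zero_iff)
  have wv: "((\<lambda>r. \<Phi> (coord i (L r)) + \<Phi> (F i (m r))) has_vector_derivative w + v) (at s within I)"
    by (rule has_vector_derivative_add[OF w v])
  show ?thesis
    unfolding iff
  proof
    assume "w + v = 0"
    with wv show "((\<lambda>r. \<Phi> (coord i (L r)) + \<Phi> (F i (m r))) has_vector_derivative 0) (at s within I)"
      by simp
  next
    assume "((\<lambda>r. \<Phi> (coord i (L r)) + \<Phi> (F i (m r))) has_vector_derivative 0) (at s within I)"
    from vector_derivative_within[OF lim wv] vector_derivative_within[OF lim this] show "w + v = 0" by simp
  qed
qed

lemma horizontal_coord:
  assumes i: "i \<in> {1..num H}" and "a < b" and L: "differentiable_curve (tot H i) {a..b} L"
    and m: "differentiable_curve (base H i) {a..b} m" and mU: "\<And>r. r \<in> {a..b} \<Longrightarrow> m r \<in> U i"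
    and Lm: "\<And>r. r \<in> {a..b} \<Longrightarrow> proj i (L r) = m r"
    and hor: "\<And>s. s \<in> {a..b} \<Longrightarrow> \<omega> i (L s) (velocity (tot H i) {a..b} L s) = (\<lambda>_. 0)"
  shows "\<Phi> (coord i (L b)) = \<Phi> (coord i (L a)) - (\<Phi> (F i (m b)) - \<Phi> (F i (m a)))"
proof -
  let ?c = "\<lambda>r. \<Phi> (coord i (L r)) + \<Phi> (F i (m r))"
  have "((\<lambda>_. 0) has_integral (?c b - ?c a)) {a..b}"
  proof (rule fundamental_theorem_of_calculus)
    show "a \<le> b" using assms(2) by simp
    fix s assume s: "s \<in> {a..b}"
    have lim: "at s within {a..b} \<noteq> bot"
      using s assms(2) by (simp add: trivial_limit_within islimpt_Icc)
    show "(?c has_vector_derivative 0) (at s within {a..b})"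
      using horizontal_iff[OF i L m mU Lm s lim] hor[OF s] by simp
  qed
  then have "?c b = ?c a" using has_integral_unique[OF _ has_integral_0] by fastforce
  then show ?thesis by (simp add: algebra_simps)
qed

end

section \<open>Holonomy of hybrid loops\<close>

locale trivialized_hybrid_loop = trivialized_hybrid_bundle G \<Phi> H \<omega> U \<sigma> A F
  for G :: "('h, 'w::euclidean_space) lie_grp" and \<Phi> :: "'h \<Rightarrow> real ^ 'd"
    and H :: "('e, 'u::euclidean_space, 'm, 'v::euclidean_space, 'h) hybrid_bundle"
    and \<omega> :: "nat \<Rightarrow> ('e, 'h) lie_valued_form" and U :: "nat \<Rightarrow> 'm set" and \<sigma> :: "nat \<Rightarrow> 'm \<Rightarrow> 'e"
    and A :: "nat \<Rightarrow> ('m, 'h) lie_valued_form" and F :: "nat \<Rightarrow> 'm \<Rightarrow> 'h" +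
  fixes \<gamma> :: "real \<Rightarrow> nat \<times> 'm" and t :: "nat \<Rightarrow> real" and N :: nat and e\<^sub>0 :: 'e
  assumes loop: "hybrid_loop H N t \<gamma>" and loop_in_U: "hybrid_curve_in H U N t \<gamma>"
    and e\<^sub>0: "e\<^sub>0 \<in> part_over (comp_bundle H (fst (\<gamma> 0))) {snd (\<gamma> 0)}"
begin

abbreviation idx :: "nat \<Rightarrow> nat" where "idx \<equiv> comp_index \<gamma> t"
abbreviation I :: "nat \<Rightarrow> real set" where "I k \<equiv> {t k..t (Suc k)}"
abbreviation mpiece :: "nat \<Rightarrow> real \<Rightarrow> 'm" where "mpiece k \<equiv> piece (base_union H) \<gamma> (t k)"

section \<open>Pieces and transitions of the loop\<close>

lemma curve: "hybrid_curve (num H) (base H) N t \<gamma>" and closed: "\<gamma> 0 = \<gamma> 1"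
  using loop by (simp_all add: hybrid_loop_def)

lemmas t_start = hybrid_curve_partition(1)[OF curve]
  and t_end = hybrid_curve_partition(2)[OF curve]
  and t_less = hybrid_curve_partition(3)[OF curve]
  and t_unit = hybrid_curve_partition(4)[OF curve]

lemmas idx_range = hybrid_curve_piece(1)[OF hausdorff_base curve]
  and mpiece_curve = hybrid_curve_piece(2)[OF hausdorff_base curve]
  and \<gamma>_eq = hybrid_curve_piece(3)[OF hausdorff_base curve]
  and after_eq = hybrid_curve_piece(4)[OF hausdorff_base curve]
  and before_eq = hybrid_curve_piece(5)[OF hausdorff_base curve]

lemma I_unit: "k \<le> N \<Longrightarrow> I k \<subseteq> {0..1}"
  using t_unit[of k] t_unit[of "Suc k"] by auto

lemma \<gamma>_end: "k \<le> N \<Longrightarrow> \<gamma> (t (Suc k)) = (idx k, mpiece k (t (Suc k)))"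
  using \<gamma>_eq t_less by simp

lemma after_start: "value_after (base_union H) \<gamma> (t 0) = \<gamma> 0"
  by (rule hybrid_curve_value_after_start[OF hausdorff_base curve])

lemma \<gamma>_0: "\<gamma> 0 = (idx 0, mpiece 0 0)"
  using after_start after_eq[of 0] t_start by simp

lemma \<gamma>_1: "\<gamma> 1 = (idx N, mpiece N 1)"
  using \<gamma>_end[of N] t_end by simp

lemma idx_closed: "idx N = idx 0" and mpiece_closed: "mpiece N 1 = mpiece 0 0"
  using closed \<gamma>_0 \<gamma>_1 by simp_all

text \<open>Two cases, because \<open>mpiece k (t k)\<close> is by definition a value after
  \<open>t k\<close> and not a value of \<gamma>; \<open>hybrid_curve_in\<close> places such values
  in \<open>U\<close> by a separate clause.\<close>

lemma mpiece_U: "k \<le> N \<Longrightarrow> s \<in> I k \<Longrightarrow> mpiece k s \<in> U (idx k)"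
proof (cases "s = t k")
  case True
  assume "k \<le> N"
  then show ?thesis using loop_in_U after_eq[of k] True by (auto simp: hybrid_curve_in_def)
next
  case False
  assume k: "k \<le> N" and s: "s \<in> I k"
  then have "\<gamma> s \<in> Sigma {1..num H} U" using loop_in_U I_unit[OF k] by (auto simp: hybrid_curve_in_def)
  then show ?thesis using \<gamma>_eq[OF k, of s] s False by auto
qed

text \<open>The transition at \<open>t k\<close> has some target \<open>j\<close>, and the reset
  point in component \<open>j\<close> is a right-hand limit of the loop. So is the start of piece
  \<open>k\<close>; uniqueness of limits gives \<open>j = idx k\<close> together with the
  value.\<close>

lemma transition_jump:
  assumes k: "k \<in> {1..N}"
  shows "mpiece (k - 1) (t k) \<in> guard H (idx (k - 1)) (idx k)"
    and "mpiece k (t k) = reset H (idx (k - 1)) (idx k) (mpiece (k - 1) (t k))"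
proof -
  have "t k \<in> {s. \<exists>j. transition H \<gamma> s j}" using loop k by (simp add: hybrid_loop_def)
  then obtain j where j: "transition H \<gamma> (t k) j" by blast
  have k': "k - 1 \<le> N" "Suc (k - 1) = k" using k by auto
  have g: "\<gamma> (t k) = (idx (k - 1), mpiece (k - 1) (t k))" using \<gamma>_end[OF k'(1)] k'(2) by simp
  have "limitin (base_union H) \<gamma> (j, reset H (fst (\<gamma> (t k))) j (snd (\<gamma> (t k)))) (at_right (t k))"
    using loop j by (simp add: hybrid_loop_def)
  note after = value_after_eq[OF hausdorff_base this, unfolded g fst_conv snd_conv]
  have "k \<le> N" using k by simp
  from trans[OF after_eq[OF this, symmetric] after]
  have a: "(idx k, mpiece k (t k)) = (j, reset H (idx (k - 1)) j (mpiece (k - 1) (t k)))" .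
  then have j_eq: "j = idx k" by simp
  from a show "mpiece k (t k) = reset H (idx (k - 1)) (idx k) (mpiece (k - 1) (t k))"
    unfolding j_eq by (rule Pair_inject)
  show "mpiece (k - 1) (t k) \<in> guard H (idx (k - 1)) (idx k)"
    using j unfolding transition_def g j_eq by simp
qed

lemma hybrid_integral_eq:
  "hybrid_integral \<Phi> H A N t \<gamma> =
    (\<Sum>k=0..N. \<Phi> (F (idx k) (mpiece k (t (Suc k)))) - \<Phi> (F (idx k) (mpiece k (t k))))"
  unfolding hybrid_integral_def
proof (rule sum.cong[OF refl])
  fix k assume "k \<in> {0..N}"
  then have k: "k \<le> N" by simp
  show "integral (I k) (\<lambda>s. lie_algebra_coords \<Phi>
          (A (idx k) (mpiece k s) (velocity (base H (idx k)) (I k) (mpiece k) s))) =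
      \<Phi> (F (idx k) (mpiece k (t (Suc k)))) - \<Phi> (F (idx k) (mpiece k (t k)))"
    by (rule form_integral[OF idx_range[OF k] t_less[OF k] mpiece_curve[OF k] mpiece_U[OF k]])
qed

section \<open>Horizontal lifts of the loop\<close>

lemma e\<^sub>0_triv: "e\<^sub>0 \<in> triv_part (idx 0)" and proj_e\<^sub>0: "proj (idx 0) e\<^sub>0 = mpiece 0 0"
  using e\<^sub>0 mpiece_U[of 0 0] t_less[of 0] t_start \<gamma>_0 by (auto simp: part_over_def)

text \<open>To apply \<open>resets_trivial\<close>, the reset point must lie in the trivialized part
  of the next component. It does, because the loop stays in the sets \<open>U\<close> also just
  after a transition.\<close>

lemma reset_coord:
  assumes k: "k \<in> {1..N}" and e: "e \<in> triv_part (idx (k - 1))" and pe: "proj (idx (k - 1)) e = mpiece (k - 1) (t k)"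
  shows "lifted_reset H (idx (k - 1)) (idx k) e \<in> triv_part (idx k)"
    and "proj (idx k) (lifted_reset H (idx (k - 1)) (idx k) e) = mpiece k (t k)"
    and "coord (idx k) (lifted_reset H (idx (k - 1)) (idx k) e) = coord (idx (k - 1)) e"
proof -
  let ?i = "idx (k - 1)" and ?j = "idx k"
  have i: "?i \<in> {1..num H}" and j: "?j \<in> {1..num H}" using idx_range k by auto
  have eg: "e \<in> part_over (comp_bundle H ?i) (guard H ?i ?j)"
    and eg': "e \<in> part_over (comp_bundle H ?i) (guard H ?i ?j \<inter> U ?i)"
    using e pe transition_jump(1)[OF k] by (simp_all add: part_over_def)
  have mU: "mpiece k (t k) \<in> U ?j" using mpiece_U[of k "t k"] t_less[of k] k by simp
  show p: "proj ?j (lifted_reset H ?i ?j e) = mpiece k (t k)"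
    using hybrid_bundle i j eg pe transition_jump(2)[OF k] by (simp add: hybrid_principal_bundle_def)
  have "lifted_reset H ?i ?j ` part_over (comp_bundle H ?i) (guard H ?i ?j) \<subseteq> points (tot H ?j)"
    using hybrid_bundle i j by (simp add: hybrid_principal_bundle_def)
  then have "lifted_reset H ?i ?j e \<in> points (tot H ?j)" using eg by blast
  then show "lifted_reset H ?i ?j e \<in> triv_part ?j" using p mU by (simp add: part_over_def)
  have "reset H ?i ?j (proj ?i e) \<in> U ?j" using mU unfolding pe transition_jump(2)[OF k] .
  from resets_trivial[OF i j eg' this] show "coord ?j (lifted_reset H ?i ?j e) = coord ?i e" .
qed

text \<open>Stated for an arbitrary lift, which later makes the holonomy element unique. The group
  coordinate is followed through the pieces: \<open>horizontal_coord\<close> gives its change along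
  a piece, and \<open>reset_coord\<close> shows that it survives a reset.\<close>

lemma lift_end:
  assumes lift: "hybrid_lift H \<omega> N t \<gamma> e\<^sub>0 \<gamma>'"
  shows "snd (\<gamma>' 1) \<in> triv_part (idx 0)" and "proj (idx 0) (snd (\<gamma>' 1)) = mpiece 0 0"
    and "\<Phi> (coord (idx 0) (snd (\<gamma>' 1))) = \<Phi> (coord (idx 0) e\<^sub>0) - hybrid_integral \<Phi> H A N t \<gamma>"
proof -
  define L where "L k = piece (tot_union H) \<gamma>' (t k)" for k
  have curve': "hybrid_curve (num H) (tot H) N t \<gamma>'" using lift by (simp add: hybrid_lift_def)
  have over: "fst (\<gamma>' s) = fst (\<gamma> s)" "proj (fst (\<gamma> s)) (snd (\<gamma>' s)) = snd (\<gamma> s)" if "s \<in> {0..1}" for s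
    using lift that by (auto simp: hybrid_lift_def)
  have idx': "comp_index \<gamma>' t k = idx k" if "k \<le> N" for k
    using over(1) t_unit[of "Suc k"] that by (simp add: comp_index_def)
  note piece' = hybrid_curve_piece[OF hausdorff_tot curve', folded L_def]
  have L: "differentiable_curve (tot H (idx k)) (I k) (L k)" if "k \<le> N" for k
    using piece'(2)[OF that] idx'[OF that] by simp
  have \<gamma>': "\<gamma>' s = (idx k, L k s)" if "k \<le> N" "s \<in> {t k<..t (Suc k)}" for k s
    using piece'(3)[OF that] idx'[OF that(1)] by simp
  have Lend: "\<gamma>' (t (Suc k)) = (idx k, L k (t (Suc k)))" if "k \<le> N" for k
    using \<gamma>'[OF that] t_less[OF that] by simp
  have proj_interior: "proj (idx k) (L k s) = mpiece k s" if k: "k \<le> N" and s: "s \<in> {t k<..t (Suc k)}" for k s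
  proof -
    have "s \<in> {0..1}" using I_unit[OF k] s by auto
    with over(2)[of s] \<gamma>'[OF k s] \<gamma>_eq[OF k s] show ?thesis by simp
  qed
  \<comment> \<open>The clause of \<open>hybrid_lift\<close> on projections concerns values of
    \<open>\<gamma>'\<close>, and for \<open>k > 0\<close> the value at \<open>t k\<close> belongs
    to the piece before. For the start of piece \<open>k\<close> the projection is found by passing
    to the limit from the right, in a Hausdorff base.\<close>
  have proj_start: "proj (idx k) (L k (t k)) = mpiece k (t k)" if k: "k \<le> N" for k
  proof -
    have "differentiable_curve (base H (idx k)) (I k) (\<lambda>s. proj (idx k) (L k s))"
      by (rule smooth_map_curve[OF smooth_proj[OF idx_range[OF k]] L[OF k]])
        (rule differentiable_curve_in_points[OF L[OF k]])
    from curve_limit_right[OF this _ t_less[OF k]]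
    have "limitin (man_top (base H (idx k))) (\<lambda>s. proj (idx k) (L k s)) (proj (idx k) (L k (t k))) (at_right (t k))"
      by simp
    moreover have "eventually (\<lambda>s. proj (idx k) (L k s) = mpiece k s) (at_right (t k))"
      using eventually_at_right_real[OF t_less[OF k]]
      by (rule eventually_mono) (simp add: proj_interior[OF k])
    ultimately have "limitin (man_top (base H (idx k))) (mpiece k) (proj (idx k) (L k (t k))) (at_right (t k))"
      by (rule limitin_cong_eventually)
    moreover have "limitin (man_top (base H (idx k))) (mpiece k) (mpiece k (t k)) (at_right (t k))"
      by (rule curve_limit_right[OF mpiece_curve[OF k] _ t_less[OF k]]) simp
    moreover have "Hausdorff_space (man_top (base H (idx k)))"
      using hausdorff_base idx_range[OF k] by (simp add: hausdorff_family_def)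
    ultimately show ?thesis by (intro limitin_Hausdorff_unique[where F = "at_right (t k)"]) auto
  qed
  have Lm: "proj (idx k) (L k s) = mpiece k s" if "k \<le> N" "s \<in> I k" for k s
    using proj_interior[OF that(1), of s] proj_start[OF that(1)] that(2) by (cases "s = t k") auto
  have LU: "L k s \<in> triv_part (idx k)" if k: "k \<le> N" and s: "s \<in> I k" for k s
    using differentiable_curve_in_points[OF L[OF k] s] mpiece_U[OF k s] Lm[OF k s] by (simp add: part_over_def)
  define J where "J k = \<Phi> (F (idx k) (mpiece k (t (Suc k)))) - \<Phi> (F (idx k) (mpiece k (t k)))" for k
  have step: "\<Phi> (coord (idx k) (L k (t (Suc k)))) = \<Phi> (coord (idx k) (L k (t k))) - J k" if k: "k \<le> N" for k
    unfolding J_def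
  proof (rule horizontal_coord[OF idx_range[OF k] t_less[OF k] L[OF k] mpiece_curve[OF k] mpiece_U[OF k] Lm[OF k]])
    show "\<omega> (idx k) (L k s) (velocity (tot H (idx k)) (I k) (L k) s) = (\<lambda>_. 0)" if "s \<in> I k" for s
      using lift k that by (simp add: hybrid_lift_def L_def)
  qed
  have start: "L 0 0 = e\<^sub>0"
  proof -
    have "(idx 0, L 0 0) = \<gamma>' 0"
      using piece'(4)[of 0] hybrid_curve_value_after_start[OF hausdorff_tot curve'] idx'[of 0] t_start by simp
    moreover have "\<gamma>' 0 = (fst (\<gamma> 0), e\<^sub>0)" using lift by (simp add: hybrid_lift_def)
    ultimately show ?thesis by simp
  qed
  have jump: "coord (idx k) (L k (t k)) = coord (idx (k - 1)) (L (k - 1) (t k))" if k: "k \<in> {1..N}" for k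
  proof -
    have k': "k - 1 \<le> N" "k \<le> N" "Suc (k - 1) = k" using k by auto
    have "value_before (tot_union H) \<gamma>' (t k) = (idx (k - 1), L (k - 1) (t k))"
      using piece'(5)[OF k'(1)] Lend[OF k'(1)] k'(3) by simp
    then have "value_after (tot_union H) \<gamma>' (t k) = (idx k, lifted_reset H (idx (k - 1)) (idx k) (L (k - 1) (t k)))"
      using lift k by (simp add: hybrid_lift_def)
    then have "L k (t k) = lifted_reset H (idx (k - 1)) (idx k) (L (k - 1) (t k))"
      using piece'(4)[OF k'(2)] by simp
    moreover have "t k \<in> I (k - 1)" using t_less[OF k'(1)] k'(3) by simp
    ultimately show ?thesis
      using reset_coord(3)[OF k LU[OF k'(1)] Lm[OF k'(1)]] by simp
  qed
  \<comment> \<open>Going from \<open>k\<close> to \<open>Suc k\<close>, \<open>jump\<close>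
    identifies the coordinate at the start of the new piece with the one at the end of the old
    piece, and \<open>step\<close> subtracts the increase along the new piece.\<close>
  have "\<Phi> (coord (idx k) (L k (t (Suc k)))) = \<Phi> (coord (idx 0) e\<^sub>0) - (\<Sum>j=0..k. J j)" if "k \<le> N" for k
    using that
  proof (induction k)
    case 0
    then show ?case using step[of 0] start t_start by simp
  next
    case (Suc k)
    then show ?case using step[of "Suc k"] jump[of "Suc k"] by simp
  qed
  from this[of N] show "\<Phi> (coord (idx 0) (snd (\<gamma>' 1))) = \<Phi> (coord (idx 0) e\<^sub>0) - hybrid_integral \<Phi> H A N t \<gamma>"
    using Lend[of N] t_end idx_closed by (simp add: hybrid_integral_eq J_def)
  show "snd (\<gamma>' 1) \<in> triv_part (idx 0)" "proj (idx 0) (snd (\<gamma>' 1)) = mpiece 0 0"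
    using LU[of N 1] Lm[of N 1] Lend[of N] t_end t_less[of N] idx_closed mpiece_closed by simp_all
qed

lemma lift_exists: "\<exists>\<gamma>'. hybrid_lift H \<omega> N t \<gamma> e\<^sub>0 \<gamma>'"
proof -
  define \<Phi>F where "\<Phi>F k s = \<Phi> (F (idx k) (mpiece k s))" for k s
  text \<open>Along a horizontal lift \<open>\<Phi> g + \<Phi> (F m)\<close> is constant on each piece; \<open>c k\<close> is its value on the
    \<open>k\<close>-th one, with jumps chosen such that \<open>g\<close> is preserved by the resets.\<close>
  define c where "c k = \<Phi> (coord (idx 0) e\<^sub>0) + \<Phi>F 0 0 + (\<Sum>l=1..k. \<Phi>F l (t l) - \<Phi>F (l - 1) (t l))" for k
  define L where "L k s = lift_point (idx k) (mpiece k s) (\<Psi> (c k - \<Phi>F k s))" for k s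
  \<comment> \<open>The least such \<open>k\<close> is the piece with \<open>s\<close> in
    \<open>{t k<..t (Suc k)}\<close>, so a transition time is assigned to the piece before it;
    \<open>s = 0\<close> falls to piece 0.\<close>
  define \<gamma>' where "\<gamma>' s = (fst (\<gamma> s), L (LEAST k. s \<le> t (Suc k)) s)" for s
  have L_triv: "L k s \<in> triv_part (idx k)" and L_proj: "proj (idx k) (L k s) = mpiece k s"
    and L_coord: "coord (idx k) (L k s) = \<Psi> (c k - \<Phi>F k s)" if "k \<le> N" "s \<in> I k" for k s
    using lift_point[OF idx_range[OF that(1)] mpiece_U[OF that] \<Psi>_carrier] by (simp_all add: L_def)
  have L_curve: "differentiable_curve (tot H (idx k)) (I k) (L k)" if k: "k \<le> N" for k
    unfolding L_def
  proof (rule lift_point_curve[OF idx_range[OF k] mpiece_curve[OF k] mpiece_U[OF k]])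
    fix s assume s: "s \<in> I k"
    have "differentiable_curve (grp_man G) (I k) (\<lambda>r. F (idx k) (mpiece k r))"
      using U_points[OF idx_range[OF k]] mpiece_U[OF k]
      by (intro smooth_map_curve[OF smooth_F[OF idx_range[OF k]] mpiece_curve[OF k]]) auto
    from \<Phi>_curve_differentiable[OF this s]
    show "(\<lambda>r. c k - \<Phi>F k r) differentiable (at s within I k)"
      unfolding \<Phi>F_def by (intro differentiable_diff differentiable_const)
  qed
  have L_horizontal: "\<omega> (idx k) (L k s) (velocity (tot H (idx k)) (I k) (L k) s) = (\<lambda>_. 0)"
    if k: "k \<le> N" and s: "s \<in> I k" for k s
  proof -
    have lim: "at s within I k \<noteq> bot"
      using s t_less[OF k] by (simp add: trivial_limit_within islimpt_Icc)
    have "\<Phi> (coord (idx k) (L k r)) + \<Phi> (F (idx k) (mpiece k r)) = c k" if "r \<in> I k" for r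
      using L_coord[OF k that] by (simp add: \<Phi>F_def)
    then have "((\<lambda>r. \<Phi> (coord (idx k) (L k r)) + \<Phi> (F (idx k) (mpiece k r))) has_vector_derivative 0) (at s within I k)"
      by (intro has_vector_derivative_transform[OF s _ has_vector_derivative_const[of "c k"]]) auto
    then show ?thesis
      using horizontal_iff[OF idx_range[OF k] L_curve[OF k] mpiece_curve[OF k] mpiece_U[OF k] L_proj[OF k] s lim]
      by simp
  qed
  have L_start: "L 0 0 = e\<^sub>0"
  proof (rule triv_part_eqI[OF idx_range[of 0] _ e\<^sub>0_triv])
    have s: "0 \<in> I 0" using t_less[of 0] t_start by simp
    show "L 0 0 \<in> triv_part (idx 0)" "proj (idx 0) (L 0 0) = proj (idx 0) e\<^sub>0"
      using L_triv[OF _ s] L_proj[OF _ s] proj_e\<^sub>0 by simp_all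
    \<comment> \<open>The sum in \<open>c 0\<close> is empty, so \<open>c 0 - \<Phi>F 0 0\<close> is
      the image under \<Phi> of the coordinate of \<open>e\<^sub>0\<close>.\<close>
    show "coord (idx 0) (L 0 0) = coord (idx 0) e\<^sub>0"
      using L_coord[OF _ s] coord_carrier[OF idx_range[of 0] e\<^sub>0_triv] by (simp add: c_def)
  qed simp
  have \<gamma>'_eq: "\<gamma>' s = (idx k, L k s)" if "k \<le> N" "s \<in> {t k<..t (Suc k)}" for k s
    using Least_partition[of N t, OF t_less that] \<gamma>_eq[OF that] by (simp add: \<gamma>'_def)
  have "(LEAST k. 0 \<le> t (Suc k)) = 0"
    by (rule Least_eq_0) (use t_less[of 0] t_start in simp)
  then have \<gamma>'_0: "\<gamma>' 0 = (idx 0, L 0 0)" by (simp add: \<gamma>'_def \<gamma>_0)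
  note glue_facts = hausdorff_tot t_start t_end t_less idx_range L_curve \<gamma>'_eq \<gamma>'_0
  have glue1: "hybrid_curve (num H) (tot H) N t \<gamma>'"
    by (rule hybrid_curve_glue(1)[where i = idx and L = L]) (fact glue_facts)+
  have glue2: "comp_index \<gamma>' t k = idx k" if k: "k \<le> N" for k
    by (rule hybrid_curve_glue(2)[where i = idx and L = L and X = "tot H" and n = "num H", OF _ _ _ _ _ _ _ _ k])
      (fact glue_facts)+
  have glue3: "piece (tot_union H) \<gamma>' (t k) s = L k s" if k: "k \<le> N" and s: "s \<in> I k" for k s
    by (rule hybrid_curve_glue(3)[where i = idx and L = L and X = "tot H" and n = "num H", OF _ _ _ _ _ _ _ _ k s])
      (fact glue_facts)+
  note glue = glue1 glue2 glue3
  note piece' = hybrid_curve_piece[OF hausdorff_tot glue(1)]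
  have "hybrid_lift H \<omega> N t \<gamma> e\<^sub>0 \<gamma>'"
    unfolding hybrid_lift_def
  proof (intro conjI ballI allI impI)
    show "hybrid_curve (num H) (tot H) N t \<gamma>'" by (rule glue(1))
    show "\<gamma>' 0 = (fst (\<gamma> 0), e\<^sub>0)" by (simp add: \<gamma>'_0 \<gamma>_0 L_start)
    fix s :: real assume s: "s \<in> {0..1}"
    show "fst (\<gamma>' s) = fst (\<gamma> s)" by (simp add: \<gamma>'_def)
    show "proj (fst (\<gamma> s)) (snd (\<gamma>' s)) = snd (\<gamma> s)"
    proof (cases "s = 0")
      case True
      then show ?thesis using proj_e\<^sub>0 by (simp add: \<gamma>'_0 \<gamma>_0 L_start)
    next
      case False
      then have "t 0 < s" "s \<le> t (Suc N)" using s t_start t_end by auto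
      then obtain k where "k \<le> N" "s \<in> {t k<..t (Suc k)}" by (rule partition_cover)
      then show ?thesis using \<gamma>'_eq \<gamma>_eq L_proj by simp
    qed
  next
    fix k s assume k: "k \<le> N" and s: "s \<in> I k"
    have "velocity (tot H (idx k)) (I k) (piece (tot_union H) \<gamma>' (t k)) s = velocity (tot H (idx k)) (I k) (L k) s"
      by (rule velocity_cong[OF s glue(3)[OF k]])
    then show "\<omega> (idx k) (piece (tot_union H) \<gamma>' (t k) s)
        (velocity (tot H (idx k)) (I k) (piece (tot_union H) \<gamma>' (t k)) s) = (\<lambda>_. 0)"
      using L_horizontal[OF k s] glue(3)[OF k s] by simp
  next
    fix k assume k: "k \<in> {1..N}"
    then have k': "k - 1 \<le> N" "k \<le> N" "Suc (k - 1) = k" by auto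
    have tk: "t k \<in> I (k - 1)" "t k \<in> I k" "t k \<in> {t (k - 1)<..t (Suc (k - 1))}"
      using t_less[OF k'(1)] t_less[OF k'(2)] k'(3) by auto
    have before: "value_before (tot_union H) \<gamma>' (t k) = (idx (k - 1), L (k - 1) (t k))"
      using piece'(5)[OF k'(1)] \<gamma>'_eq[OF k'(1) tk(3)] k'(3) by simp
    have after: "value_after (tot_union H) \<gamma>' (t k) = (idx k, L k (t k))"
      using piece'(4)[OF k'(2)] glue(2)[OF k'(2)] glue(3)[OF k'(2) tk(2)] by simp
    note reset = reset_coord[OF k L_triv[OF k'(1) tk(1)] L_proj[OF k'(1) tk(1)]]
    have "c k = c (k - 1) + (\<Phi>F k (t k) - \<Phi>F (k - 1) (t k))"
      using k by (cases k) (simp_all add: c_def)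
    then have "coord (idx k) (L k (t k)) = coord (idx (k - 1)) (L (k - 1) (t k))"
      unfolding L_coord[OF k'(2) tk(2)] L_coord[OF k'(1) tk(1)] by simp
    \<comment> \<open>In the trivialized part a point is determined by its projection and its group
      coordinate, so the pieces, although built independently, satisfy the reset condition.\<close>
    then have "L k (t k) = lifted_reset H (idx (k - 1)) (idx k) (L (k - 1) (t k))"
      using reset L_proj[OF k'(2) tk(2)]
      by (intro triv_part_eqI[OF idx_range[OF k'(2)] L_triv[OF k'(2) tk(2)]]) simp_all
    then show "value_after (tot_union H) \<gamma>' (t k) =
        (idx k, lifted_reset H (idx (k - 1)) (idx k) (snd (value_before (tot_union H) \<gamma>' (t k))))"
      by (simp add: before after)
  qed
  then show ?thesis by blast
qed

text \<open>All lifts from \<open>e\<^sub>0\<close> end at the same point by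
  \<open>lift_end\<close>, so at most one \<open>h\<close> can relate the two ends; for the
  converse, the action of the given \<open>h\<close> on \<open>e\<^sub>0\<close> has the projection
  and coordinate of the end of the lift from \<open>lift_exists\<close>. The coordinate of
  \<open>e\<^sub>0\<close> cancels, hence it is absent from the right-hand side.\<close>

lemma generates_holonomy_iff:
  "generates_holonomy G H \<omega> N t \<gamma> e\<^sub>0 h \<longleftrightarrow> h = \<Psi> (- hybrid_integral \<Phi> H A N t \<gamma>)"
proof
  let ?a = "action (comp_bundle H (idx 0)) e\<^sub>0"
  have i: "idx 0 \<in> {1..num H}" using idx_range[of 0] by simp
  note coord_e\<^sub>0 = coord_carrier[OF i e\<^sub>0_triv]
  {
    assume gen: "generates_holonomy G H \<omega> N t \<gamma> e\<^sub>0 h"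
    then have h: "h \<in> carrier G" by (simp add: generates_holonomy_def)
    from gen obtain \<gamma>' where \<gamma>': "hybrid_lift H \<omega> N t \<gamma> e\<^sub>0 \<gamma>'"
      "snd (\<gamma>' 1) = action (comp_bundle H (fst (\<gamma> 0))) (snd (\<gamma>' 0)) h"
      by (auto simp: generates_holonomy_def)
    then have "snd (\<gamma>' 1) = ?a h" by (simp add: \<gamma>_0 hybrid_lift_def)
    then have "\<Phi> (coord (idx 0) e\<^sub>0) + \<Phi> h = \<Phi> (coord (idx 0) e\<^sub>0) - hybrid_integral \<Phi> H A N t \<gamma>"
      using lift_end(3)[OF \<gamma>'(1)] action_triv_part(3)[OF i e\<^sub>0_triv h] \<Phi>_mult[OF coord_e\<^sub>0 h] by simp
    then have "\<Phi> h = - hybrid_integral \<Phi> H A N t \<gamma>" by (simp add: eq_neg_iff_add_eq_0 algebra_simps)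
    then show "h = \<Psi> (- hybrid_integral \<Phi> H A N t \<gamma>)" using h by (metis \<Psi>_\<Phi>)
  }
  assume h_def: "h = \<Psi> (- hybrid_integral \<Phi> H A N t \<gamma>)"
  then have h: "h \<in> carrier G" by simp
  obtain \<gamma>' where \<gamma>': "hybrid_lift H \<omega> N t \<gamma> e\<^sub>0 \<gamma>'" using lift_exists by blast
  note act = action_triv_part[OF i e\<^sub>0_triv h]
  note lend = lift_end[OF \<gamma>']
  have "\<Phi> (coord (idx 0) (?a h)) = \<Phi> (coord (idx 0) (snd (\<gamma>' 1)))"
    using lend(3) act(3) \<Phi>_mult[OF coord_e\<^sub>0 h] by (simp add: h_def)
  then have "coord (idx 0) (snd (\<gamma>' 1)) = coord (idx 0) (?a h)"
    using \<Phi>_inject coord_carrier[OF i] act(1) lend(1) by simp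
  then have "snd (\<gamma>' 1) = ?a h"
    using lend act proj_e\<^sub>0 by (intro triv_part_eqI[OF i]) simp_all
  then have "snd (\<gamma>' 1) = action (comp_bundle H (fst (\<gamma> 0))) (snd (\<gamma>' 0)) h"
    using \<gamma>' by (simp add: \<gamma>_0 hybrid_lift_def)
  with \<gamma>' h show "generates_holonomy G H \<omega> N t \<gamma> e\<^sub>0 h" unfolding generates_holonomy_def by blast
qed

lemma holonomy_element_eq: "holonomy_element G H \<omega> N t \<gamma> e\<^sub>0 = \<Psi> (- hybrid_integral \<Phi> H A N t \<gamma>)"
  by (simp add: holonomy_element_def generates_holonomy_iff)

section \<open>The integral in terms of boundary values and guard values\<close>

lemma integral_boundary_values:
  "hybrid_integral \<Phi> H A N t \<gamma> =
    (\<Sum>k=0..N. \<Phi> (F (idx k) (snd (value_before (base_union H) \<gamma> (t (k + 1)))))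
            - \<Phi> (F (idx k) (snd (value_after (base_union H) \<gamma> (t k)))))"
  unfolding hybrid_integral_eq
  by (rule sum.cong[OF refl]) (simp add: before_eq after_eq \<gamma>_end)

lemma before_transition:
  assumes "k \<in> {1..N}"
  shows "value_before (base_union H) \<gamma> (t k) = (idx (k - 1), mpiece (k - 1) (t k))"
proof -
  have k': "k - 1 \<le> N" "Suc (k - 1) = k" using assms by auto
  show ?thesis using before_eq[OF k'(1)] \<gamma>_end[OF k'(1)] k'(2) by simp
qed

lemma after_transition:
  "k \<in> {1..N} \<Longrightarrow> value_after (base_union H) \<gamma> (t k) =
    (idx k, reset H (idx (k - 1)) (idx k) (snd (value_before (base_union H) \<gamma> (t k))))"
  using after_eq[of k] by (simp add: before_transition transition_jump(2))

lemma before_end: "value_before (base_union H) \<gamma> (t (N + 1)) = \<gamma> 0"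
  using before_eq[of N] t_end closed by simp

text \<open>The sum over pieces is regrouped by transitions: the end of piece \<open>k - 1\<close>
  is paired with the start of piece \<open>k\<close>, both determined by the point on the guard. The
  two terms left over, the end of the last piece and the start of the first, cancel because the loop
  is closed.\<close>

lemma integral_guard_values:
  "hybrid_integral \<Phi> H A N t \<gamma> =
    (\<Sum>k=1..N. \<Phi> (F (idx (k - 1)) (snd (value_before (base_union H) \<gamma> (t k))))
      - \<Phi> (F (idx k) (reset H (idx (k - 1)) (idx k) (snd (value_before (base_union H) \<gamma> (t k))))))"
proof -
  define b where "b k = \<Phi> (F (idx k) (mpiece k (t (Suc k))))" for k
  define a where "a k = \<Phi> (F (idx k) (mpiece k (t k)))" for k
  have "(\<Sum>k=0..n. b k - a k) = (\<Sum>k=1..n. b (k - 1) - a k) + b n - a 0" for n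
    by (induction n) (simp_all add: algebra_simps)
  moreover have "b N = a 0" by (simp add: a_def b_def t_start t_end idx_closed mpiece_closed)
  ultimately have "hybrid_integral \<Phi> H A N t \<gamma> = (\<Sum>k=1..N. b (k - 1) - a k)"
    by (simp add: hybrid_integral_eq a_def b_def)
  also have "\<dots> = (\<Sum>k=1..N. \<Phi> (F (idx (k - 1)) (snd (value_before (base_union H) \<gamma> (t k))))
      - \<Phi> (F (idx k) (reset H (idx (k - 1)) (idx k) (snd (value_before (base_union H) \<gamma> (t k))))))"
    by (rule sum.cong[OF refl]) (simp add: a_def b_def before_transition transition_jump(2))
  finally show ?thesis .
qed

end

text \<open>The assumption \<open>resets_trivial\<close> keeps the lifted resets from contributing
  group elements of their own to the holonomy. The last conjunct makes dependence on the guards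
  alone precise: another loop, with its own transition times and starting point, has the same
  holonomy as soon as its values before the transitions and the components it enters agree.\<close>

theorem mainTheorem1:
  fixes G :: "('h, 'w::euclidean_space) lie_grp"
    and \<Phi> :: "'h \<Rightarrow> real ^ 'd"
    and H :: "('e, 'u::euclidean_space, 'm, 'v::euclidean_space, 'h) hybrid_bundle"
    and \<omega> :: "nat \<Rightarrow> ('e, 'h) lie_valued_form"
    and U :: "nat \<Rightarrow> 'm set"
    and \<sigma> :: "nat \<Rightarrow> 'm \<Rightarrow> 'e"
    and A :: "nat \<Rightarrow> ('m, 'h) lie_valued_form"
    and F :: "nat \<Rightarrow> 'm \<Rightarrow> 'h"
    and \<gamma> :: "real \<Rightarrow> nat \<times> 'm"
    and t :: "nat \<Rightarrow> real" and N :: nat and m\<^sub>0 :: "nat \<times> 'm" and e\<^sub>0 :: 'e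
  assumes "lie_group G" and "comm_group G" and "lie_group_iso_Rn G \<Phi>"
    and "hybrid_principal_bundle G H"
    and connection: "\<And>i. i \<in> {1..num H} \<Longrightarrow> connection_form G (comp_bundle H i) (\<omega> i)"
    and "\<And>i. i \<in> {1..num H} \<Longrightarrow> local_section (comp_bundle H i) (U i) (\<sigma> i)"
    and "\<And>i. i \<in> {1..num H} \<Longrightarrow>
      local_trivialization G (comp_bundle H i) (U i) (section_trivialization G (comp_bundle H i) (\<sigma> i))"
    and "\<And>i. i \<in> {1..num H} \<Longrightarrow> smooth_form_on (base H i) G (U i) (A i)"
    and connection_coords: "\<And>i e X. \<lbrakk>i \<in> {1..num H}; e \<in> part_over (comp_bundle H i) (U i);
        X \<in> tangent_space (tot H i) e\<rbrakk> \<Longrightarrow>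
      \<omega> i e X = (\<lambda>f. grp_differential G (grp_coord G (comp_bundle H i) (\<sigma> i)) e X f
        + A i (bundle_proj (comp_bundle H i) e)
            (pushforward (base H i) (bundle_proj (comp_bundle H i) e) (bundle_proj (comp_bundle H i)) X) f)"
    and guards_meet: "\<And>i j. \<lbrakk>i \<in> {1..num H}; j \<in> {1..num H}; guard H i j \<noteq> {}\<rbrakk> \<Longrightarrow>
      guard H i j \<inter> U i \<noteq> {}"
    and resets_trivial: "\<And>i j e. \<lbrakk>i \<in> {1..num H}; j \<in> {1..num H};
        e \<in> part_over (comp_bundle H i) (guard H i j \<inter> U i);
        reset H i j (bundle_proj (comp_bundle H i) e) \<in> U j\<rbrakk> \<Longrightarrow>
      grp_coord G (comp_bundle H j) (\<sigma> j) (lifted_reset H i j e) =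
      grp_coord G (comp_bundle H i) (\<sigma> i) e"
    and "\<And>i. i \<in> {1..num H} \<Longrightarrow> smooth_map (base H i) (grp_man G) (points (base H i)) (F i)"
    and exact: "\<And>i m X. \<lbrakk>i \<in> {1..num H}; m \<in> U i; X \<in> tangent_space (base H i) m\<rbrakk> \<Longrightarrow>
      A i m X = grp_differential G (F i) m X"
    and loop: "hybrid_loop H N t \<gamma>" "hybrid_curve_in H U N t \<gamma>" "\<gamma> 0 = m\<^sub>0" "\<gamma> 1 = m\<^sub>0"
    and "e\<^sub>0 \<in> part_over (comp_bundle H (fst m\<^sub>0)) {snd m\<^sub>0}"
  shows "(\<exists>!h. generates_holonomy G H \<omega> N t \<gamma> e\<^sub>0 h)
    \<and> \<Phi> (holonomy_element G H \<omega> N t \<gamma> e\<^sub>0) = - hybrid_integral \<Phi> H A N t \<gamma>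
    \<and> hybrid_integral \<Phi> H A N t \<gamma> =
        (\<Sum>k=0..N. \<Phi> (F (comp_index \<gamma> t k) (snd (value_before (base_union H) \<gamma> (t (k + 1)))))
                - \<Phi> (F (comp_index \<gamma> t k) (snd (value_after (base_union H) \<gamma> (t k)))))
    \<and> value_after (base_union H) \<gamma> (t 0) = m\<^sub>0
    \<and> value_before (base_union H) \<gamma> (t (N + 1)) = m\<^sub>0
    \<and> (\<forall>k\<in>{1..N}. value_after (base_union H) \<gamma> (t k) =
          (comp_index \<gamma> t k,
           reset H (comp_index \<gamma> t (k - 1)) (comp_index \<gamma> t k)
             (snd (value_before (base_union H) \<gamma> (t k)))))
    \<and> \<Phi> (holonomy_element G H \<omega> N t \<gamma> e\<^sub>0) =
        - (\<Sum>k=1..N.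
             \<Phi> (F (comp_index \<gamma> t (k - 1)) (snd (value_before (base_union H) \<gamma> (t k))))
           - \<Phi> (F (comp_index \<gamma> t k)
               (reset H (comp_index \<gamma> t (k - 1)) (comp_index \<gamma> t k)
                 (snd (value_before (base_union H) \<gamma> (t k))))))
    \<and> (\<forall>\<delta> s e\<^sub>1.
          hybrid_loop H N s \<delta> \<and> hybrid_curve_in H U N s \<delta> \<and>
          e\<^sub>1 \<in> part_over (comp_bundle H (fst (\<delta> 0))) {snd (\<delta> 0)} \<and>
          (\<forall>k\<in>{1..N}. value_before (base_union H) \<delta> (s k) = value_before (base_union H) \<gamma> (t k) \<and>
             comp_index \<delta> s k = comp_index \<gamma> t k) \<longrightarrow>
          holonomy_element G H \<omega> N s \<delta> e\<^sub>1 = holonomy_element G H \<omega> N t \<gamma> e\<^sub>0)"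
proof -
  interpret trivialized_hybrid_bundle G \<Phi> H \<omega> U \<sigma> A F
    by (intro trivialized_hybrid_bundle.intro lie_group_Rn.intro trivialized_hybrid_bundle_axioms.intro) fact+
  have loopI: "trivialized_hybrid_loop G \<Phi> H \<omega> U \<sigma> A F \<delta> s N e\<^sub>1"
    if "hybrid_loop H N s \<delta>" "hybrid_curve_in H U N s \<delta>"
      "e\<^sub>1 \<in> part_over (comp_bundle H (fst (\<delta> 0))) {snd (\<delta> 0)}" for \<delta> s e\<^sub>1
    by (intro trivialized_hybrid_loop.intro trivialized_hybrid_loop_axioms.intro that)
      (rule trivialized_hybrid_bundle_axioms)
  interpret trivialized_hybrid_loop G \<Phi> H \<omega> U \<sigma> A F \<gamma> t N e\<^sub>0
    by (rule loopI) (use assms in simp_all)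
  have ex1: "\<exists>!h. generates_holonomy G H \<omega> N t \<gamma> e\<^sub>0 h" by (simp add: generates_holonomy_iff)
  have hol: "\<Phi> (holonomy_element G H \<omega> N t \<gamma> e\<^sub>0) = - hybrid_integral \<Phi> H A N t \<gamma>"
    by (simp add: holonomy_element_eq)
  have indep: "holonomy_element G H \<omega> N s \<delta> e\<^sub>1 = holonomy_element G H \<omega> N t \<gamma> e\<^sub>0"
    if \<delta>: "hybrid_loop H N s \<delta>" "hybrid_curve_in H U N s \<delta>"
      "e\<^sub>1 \<in> part_over (comp_bundle H (fst (\<delta> 0))) {snd (\<delta> 0)}"
      and same: "\<forall>k\<in>{1..N}. value_before (base_union H) \<delta> (s k) = value_before (base_union H) \<gamma> (t k) \<and>
        comp_index \<delta> s k = comp_index \<gamma> t k" for \<delta> s e\<^sub>1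
  proof -
    interpret \<delta>: trivialized_hybrid_loop G \<Phi> H \<omega> U \<sigma> A F \<delta> s N e\<^sub>1
      by (rule loopI[OF \<delta>])
    \<comment> \<open>For \<open>k = 1\<close> the index \<open>k - 1 = 0\<close> lies outside the
      range compared in \<open>same\<close>; it is read off from the first component of the value
      before the transition.\<close>
    have idx_before: "comp_index \<delta> s (k - 1) = comp_index \<gamma> t (k - 1)" if "k \<in> {1..N}" for k
      using same \<delta>.before_transition[OF that] before_transition[OF that] that by simp
    have "hybrid_integral \<Phi> H A N s \<delta> = hybrid_integral \<Phi> H A N t \<gamma>"
      unfolding \<delta>.integral_guard_values integral_guard_values
    proof (rule sum.cong[OF refl])
      fix k assume k: "k \<in> {1..N}"
      show "\<Phi> (F (comp_index \<delta> s (k - 1)) (snd (value_before (base_union H) \<delta> (s k))))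
          - \<Phi> (F (comp_index \<delta> s k) (reset H (comp_index \<delta> s (k - 1)) (comp_index \<delta> s k)
              (snd (value_before (base_union H) \<delta> (s k))))) =
        \<Phi> (F (comp_index \<gamma> t (k - 1)) (snd (value_before (base_union H) \<gamma> (t k))))
          - \<Phi> (F (comp_index \<gamma> t k) (reset H (comp_index \<gamma> t (k - 1)) (comp_index \<gamma> t k)
              (snd (value_before (base_union H) \<gamma> (t k)))))"
        unfolding idx_before[OF k] using same k by simp
    qed
    then show ?thesis by (simp add: \<delta>.holonomy_element_eq holonomy_element_eq)
  qed
  show ?thesis
    using ex1 hol integral_boundary_values after_start before_end after_transition
      hol[unfolded integral_guard_values] indep \<open>\<gamma> 0 = m\<^sub>0\<close>
    by (intro conjI) auto
qed

end
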